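(* There exists $\overline{p}\in(0,1)$ such that, for all $p<\overline{p}$, an equilibrium of the full game exists and is characterized by a triple $\{\hat{x}(\varnothing),y_1,y_2\}$ satisfying $y_1\neq y_2$ and the following three conditions, where $\mathcal{Y}^{N}$ is the interval with endpoints $y_1,y_2$: $$0=\mathbb{E}\big[\theta\,\big|\,\hat{x}(\varnothing),\,y\in\{\varnothing\}\cup\mathcal{Y}^{N}\big],$$ $$\hat{x}(\varnothing)=\hat{x}(y_2),$$ $$\Pi(\hat{x}(\varnothing),y_1)=\Pi(\hat{x}(y_1),y_1).$$
   Context: Environment. The parameters are precisions $\alpha,\beta,\gamma>0$, a prior mean $\mu\in\mathbb{R}$, an externality parameter $r\in\mathbb{R}$ and a probability $p\in(0,1)$. $\theta\sim N(\mu,\gamma^{-1})$ is unobserved. A continuum of receivers $i\in[0,1]$ observe private signals $x_i|\theta\sim N(\theta,\beta^{-1})$, conditionally i.i.d. With probability $p$ the Sender observes $y|\theta\sim N(\theta,\alpha^{-1})$, conditionally independent of the $x_i$; otherwise he observes nothing ($y=\varnothing$). An informed Sender either discloses truthfully ($m=y$) or conceals ($m=\varnothing$); an uninformed Sender must send $m=\varnothing$. The Sender cannot commit to a disclosure policy. His strategy is described by the non-disclosure region $\mathcal{Y}^{N}\subseteq\mathbb{R}$ of signals he conceals. After observing $(x_i,m)$, receiver $i$ chooses $a_i\in\{0,1\}$ with payoff $rA+a_i\theta$, $A=\int_0^1a_i\,di$. Notation. $f(\cdot|\cdot)$, $F(\cdot|\cdot)$ are conditional densities and c.d.f.s of the variables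 named in the arguments under the joint normal law. If receivers use threshold $x$ (i.e. $a_i=\mathbf{1}_{x_i\ge x}$), the aggregate action in state $\theta$ is $1-F(x|\theta)$, and the benevolent Sender's interim payoff after observing $y$ is $$\Pi(x,y)=\int_{\mathbb{R}}(r+\theta)(1-F(x|\theta))\,dF(\theta|y).$$ For a disclosed $y\in\mathbb{R}$, $\hat{x}(y)=-\frac1\beta(\alpha y+\gamma\mu)$, the solution of $\mathbb{E}[\theta|x_i=\hat{x}(y),y]=0$. The expression $\mathbb{E}[\theta\,|\,x,\,y\in\{\varnothing\}\cup\mathcal{Y}^{N}]$ denotes the expectation of $\theta$ under the posterior density after $m=\varnothing$ and private signal $x$, specified as $$f(\theta|\varnothing,x)=\left(1-p+p\int_{\mathcal{Y}^{N}}\frac{f(y|\theta,x)}{\int_{\mathcal{Y}^{N}}f(y'|x)\,dy'}\,dy\right)f(\theta|x).$$ Equilibrium of the full game means Perfect Bayesian equilibrium. It consists of a threshold $\hat x(m)$ for each message $m\in\mathbb{R}\cup\{\varnothing\}$, a region $\mathcal{Y}^{N}\subseteq\mathbb{R}$, posteriors $f(\theta|m,x_i)$ and aggregate action $A(\theta,m)$ such that: (1) Posteriors are $f(\theta|y,x_i)$ if $m=y$ (including for off-path disclosures $y\in\mathcal{Y}^{N}$), and the density displayed above if $m=\varnothing$. (2) Receivers use $a_i=\mathbf{1}_{x_i\ge\hat{x}(m)}$, and this is optimal given the posteriors, the marginal receiver being indifferent: the expectation of $\theta$ under $f(\cdot|m,x_i=\hat{x}(m))$ is $0$. (3) $A(\theta,m)=1-F(\hat{x}(m)|\theta)$.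 (4) For all $y\in\mathbb{R}$: $\ \Pi(\hat{x}(\varnothing),y)\ge\Pi(\hat{x}(y),y)\iff y\in\mathcal{Y}^{N}$.
   Formalization: The formal theorem assumes r ≠ 0: for r = 0 the payoff Π(·,y) has its unique maximum at x̂(y), so the second and third conditions force y1 = y2 and no triple with y1 ≠ y2 exists. *)

theory Defs
  imports "HOL-Probability.Probability"
begin

text \<open>
  The parameters \<open>\<alpha>\<close>, \<open>\<beta>\<close>, \<open>\<gamma>\<close> are precisions, whereas \<^const>\<open>normal_density\<close>
  takes a standard deviation; hence the arguments \<open>1 / sqrt \<alpha>\<close> etc.
\<close>

definition prior_dens :: "real \<Rightarrow> real \<Rightarrow> real \<Rightarrow> real" where
  "prior_dens \<gamma> \<mu> \<theta> = normal_density \<mu> (1 / sqrt \<gamma>) \<theta>"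

definition signal_dens :: "real \<Rightarrow> real \<Rightarrow> real \<Rightarrow> real" where
  "signal_dens \<tau> \<theta> s = normal_density \<theta> (1 / sqrt \<tau>) s"

text \<open>Joint density of \<open>(\<theta>, x, y)\<close>; \<open>x\<close> and \<open>y\<close> are independent conditionally on \<open>\<theta>\<close>.\<close>

definition joint_dens ::
  "real \<Rightarrow> real \<Rightarrow> real \<Rightarrow> real \<Rightarrow> real \<Rightarrow> real \<Rightarrow> real \<Rightarrow> real" where
  "joint_dens \<alpha> \<beta> \<gamma> \<mu> \<theta> x y =
     prior_dens \<gamma> \<mu> \<theta> * signal_dens \<beta> \<theta> x * signal_dens \<alpha> \<theta> y"

text \<open>
  Conditional densities, named by what is conditioned on:
  \<open>f(\<theta>|s)\<close> for one signal \<open>s\<close> of precision \<open>\<tau>\<close> (either \<open>x\<close> or \<open>y\<close>),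
  \<open>f(\<theta>|x,y)\<close>, \<open>f(y|\<theta>,x)\<close> and \<open>f(y|x)\<close>.
\<close>

definition dens_state_signal :: "real \<Rightarrow> real \<Rightarrow> real \<Rightarrow> real \<Rightarrow> real \<Rightarrow> real" where
  "dens_state_signal \<tau> \<gamma> \<mu> s \<theta> =
     prior_dens \<gamma> \<mu> \<theta> * signal_dens \<tau> \<theta> s /
     (\<integral>t. prior_dens \<gamma> \<mu> t * signal_dens \<tau> t s \<partial>lborel)"

definition dens_state_xy ::
  "real \<Rightarrow> real \<Rightarrow> real \<Rightarrow> real \<Rightarrow> real \<Rightarrow> real \<Rightarrow> real \<Rightarrow> real" where
  "dens_state_xy \<alpha> \<beta> \<gamma> \<mu> x y \<theta> =
     joint_dens \<alpha> \<beta> \<gamma> \<mu> \<theta> x y / (\<integral>t. joint_dens \<alpha> \<beta> \<gamma> \<mu> t x y \<partial>lborel)"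

definition dens_y_state_x ::
  "real \<Rightarrow> real \<Rightarrow> real \<Rightarrow> real \<Rightarrow> real \<Rightarrow> real \<Rightarrow> real \<Rightarrow> real" where
  "dens_y_state_x \<alpha> \<beta> \<gamma> \<mu> \<theta> x y =
     joint_dens \<alpha> \<beta> \<gamma> \<mu> \<theta> x y / (\<integral>y'. joint_dens \<alpha> \<beta> \<gamma> \<mu> \<theta> x y' \<partial>lborel)"

definition dens_y_x ::
  "real \<Rightarrow> real \<Rightarrow> real \<Rightarrow> real \<Rightarrow> real \<Rightarrow> real \<Rightarrow> real" where
  "dens_y_x \<alpha> \<beta> \<gamma> \<mu> x y =
     (\<integral>t. joint_dens \<alpha> \<beta> \<gamma> \<mu> t x y \<partial>lborel) /
     (\<integral>t. prior_dens \<gamma> \<mu> t * signal_dens \<beta> t x \<partial>lborel)"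

definition cdf_x :: "real \<Rightarrow> real \<Rightarrow> real \<Rightarrow> real" where
  "cdf_x \<beta> x \<theta> = cdf (density lborel (signal_dens \<beta> \<theta>)) x"

definition sender_payoff ::
  "real \<Rightarrow> real \<Rightarrow> real \<Rightarrow> real \<Rightarrow> real \<Rightarrow> real \<Rightarrow> real \<Rightarrow> real" where
  "sender_payoff \<alpha> \<beta> \<gamma> \<mu> r x y =
     (\<integral>\<theta>. (r + \<theta>) * (1 - cdf_x \<beta> x \<theta>) * dens_state_signal \<alpha> \<gamma> \<mu> y \<theta> \<partial>lborel)"

text \<open>The private signal \<open>x\<close> at which \<open>E[\<theta>|x,y] = 0\<close>.\<close>

definition disclosure_threshold :: "real \<Rightarrow> real \<Rightarrow> real \<Rightarrow> real \<Rightarrow> real \<Rightarrow> real" where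
  "disclosure_threshold \<alpha> \<beta> \<gamma> \<mu> y = - (1 / \<beta>) * (\<alpha> * y + \<gamma> * \<mu>)"

text \<open>
  The posterior density after non-disclosure given the non-disclosure region \<open>Y\<close>. If \<open>Y\<close> is a
  null set, the quotient is a division by zero and the \<open>p\<close>-term vanishes.
\<close>

definition dens_nondisclosure ::
  "real \<Rightarrow> real \<Rightarrow> real \<Rightarrow> real \<Rightarrow> real \<Rightarrow> real set \<Rightarrow> real \<Rightarrow> real \<Rightarrow> real" where
  "dens_nondisclosure \<alpha> \<beta> \<gamma> \<mu> p Y x \<theta> =
     (1 - p + p * (LINT y:Y|lborel. dens_y_state_x \<alpha> \<beta> \<gamma> \<mu> \<theta> x y /
                                    (LINT y':Y|lborel. dens_y_x \<alpha> \<beta> \<gamma> \<mu> x y')))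
     * dens_state_signal \<beta> \<gamma> \<mu> x \<theta>"

definition nondisclosure_mean ::
  "real \<Rightarrow> real \<Rightarrow> real \<Rightarrow> real \<Rightarrow> real \<Rightarrow> real set \<Rightarrow> real \<Rightarrow> real" where
  "nondisclosure_mean \<alpha> \<beta> \<gamma> \<mu> p Y x =
     (\<integral>\<theta>. \<theta> * dens_nondisclosure \<alpha> \<beta> \<gamma> \<mu> p Y x \<theta> \<partial>lborel)"

text \<open>Messages are of type \<^typ>\<open>real option\<close>, with \<^const>\<open>None\<close> for the empty message.\<close>

definition posterior_dens ::
  "real \<Rightarrow> real \<Rightarrow> real \<Rightarrow> real \<Rightarrow> real \<Rightarrow> real set \<Rightarrow> real option \<Rightarrow> real \<Rightarrow> real \<Rightarrow> real"
where
  "posterior_dens \<alpha> \<beta> \<gamma> \<mu> p Y m x \<theta> =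
     (case m of Some y \<Rightarrow> dens_state_xy \<alpha> \<beta> \<gamma> \<mu> x y \<theta>
              | None \<Rightarrow> dens_nondisclosure \<alpha> \<beta> \<gamma> \<mu> p Y x \<theta>)"

text \<open>
  Expected payoff \<open>r A + a \<theta>\<close> of a receiver who takes action \<open>a\<close> when her belief about \<open>\<theta>\<close> has
  density \<open>g\<close> and the aggregate action in state \<open>\<theta>\<close> is \<open>B \<theta>\<close>; a single receiver is negligible,
  so \<open>B\<close> does not depend on \<open>a\<close>.
\<close>

definition receiver_payoff ::
  "real \<Rightarrow> (real \<Rightarrow> real) \<Rightarrow> (real \<Rightarrow> real) \<Rightarrow> real \<Rightarrow> real" where
  "receiver_payoff r B g a = (\<integral>\<theta>. (r * B \<theta> + a * \<theta>) * g \<theta> \<partial>lborel)"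

text \<open>
  Perfect Bayesian equilibrium: thresholds \<open>xh m\<close>, non-disclosure region \<open>Y\<close>, posterior densities
  \<open>post m x \<theta>\<close> and aggregate action \<open>A \<theta> m\<close>. Measurability of \<open>Y\<close> need not be demanded, because
  the last condition determines \<open>Y\<close> from continuous functions.
\<close>

definition perfect_bayesian_equilibrium ::
  "real \<Rightarrow> real \<Rightarrow> real \<Rightarrow> real \<Rightarrow> real \<Rightarrow> real \<Rightarrow>
   (real option \<Rightarrow> real) \<Rightarrow> real set \<Rightarrow> (real option \<Rightarrow> real \<Rightarrow> real \<Rightarrow> real) \<Rightarrow>
   (real \<Rightarrow> real option \<Rightarrow> real) \<Rightarrow> bool"
where
  "perfect_bayesian_equilibrium \<alpha> \<beta> \<gamma> \<mu> r p xh Y post A \<longleftrightarrow>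
     (\<forall>m x \<theta>. post m x \<theta> = posterior_dens \<alpha> \<beta> \<gamma> \<mu> p Y m x \<theta>) \<and>
     (\<forall>m x. \<forall>a\<in>{0, 1}. receiver_payoff r (\<lambda>\<theta>. A \<theta> m) (post m x) a
          \<le> receiver_payoff r (\<lambda>\<theta>. A \<theta> m) (post m x) (if x \<ge> xh m then 1 else 0)) \<and>
     (\<forall>m. (\<integral>\<theta>. \<theta> * post m (xh m) \<theta> \<partial>lborel) = 0) \<and>
     (\<forall>\<theta> m. A \<theta> m = 1 - cdf_x \<beta> (xh m) \<theta>) \<and>
     (\<forall>y. sender_payoff \<alpha> \<beta> \<gamma> \<mu> r (xh None) y \<ge> sender_payoff \<alpha> \<beta> \<gamma> \<mu> r (xh (Some y)) y
          \<longleftrightarrow> y \<in> Y)"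

end

theory Submission
  imports Defs
begin

text \<open>
  Parametrise signals by the threshold \<open>X = x^(y)\<close> that their disclosure induces. Differentiating the
  sender's payoff in the threshold gives \<open>-f(x|y) (r + E[\<theta>|x,y])\<close>, so the gain from disclosing \<open>y\<close>
  instead of inducing the threshold \<open>z\<close> is, up to a positive factor, \<open>X - z\<close> times the integral of
  an affine function against a Gaussian weight along the segment from \<open>X\<close> to \<open>z\<close>. Moving \<open>X\<close>
  tilts this weight exponentially, whence the integral changes sign exactly once, at some \<open>R z\<close>: the
  sender conceals exactly the signals with \<open>X\<close> between \<open>R z\<close> and \<open>z\<close>. By uniqueness \<open>R\<close> has a closed
  graph and is continuous.

  The posterior mean after non-disclosure is strictly increasing in the private signal, again by
  tilting, so indifference of the marginal receiver already makes the threshold rule optimal. It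
  remains to find \<open>z\<close> at which the posterior mean vanishes; it is \<open>1 - p\<close> times an increasing affine
  function plus \<open>p\<close> times a function that is continuous, hence bounded near the zero of the affine
  one, so for small \<open>p\<close> the intermediate value theorem applies.
\<close>

section \<open>Integrals along segments and exponential tilting\<close>

text \<open>Which endpoint of the concealment region is the larger depends on the sign of
  \<open>r\<close>; the sign of a product treats both orders at once.\<close>

lemma mem_closed_segment_real_iff:
  fixes a b x :: real
  shows "x \<in> closed_segment a b \<longleftrightarrow> (x - a) * (x - b) \<le> 0"
  by (auto simp: closed_segment_eq_real_ivl mult_le_0_iff)

text \<open>The affine substitution with slope \<open>b - a\<close>, whose absolute value covers
  both orders of the endpoints. It moves \<open>a\<close> and \<open>b\<close> from the domain into
  the integrand, where continuity in them is easy to obtain.\<close>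

lemma set_lebesgue_integral_closed_segment:
  fixes f :: "real \<Rightarrow> real"
  assumes f: "continuous_on (closed_segment a b) f" and "a \<noteq> b"
  shows "(LINT x:closed_segment a b|lborel. f x) =
    \<bar>b - a\<bar> * integral {0..1} (\<lambda>t. f (a + t * (b - a)))"
proof -
  have mem: "a + (b - a) * t \<in> closed_segment a b \<longleftrightarrow> t \<in> {0..1}" for t
  proof -
    have "(a + (b - a) * t - a) * (a + (b - a) * t - b) = (b - a)\<^sup>2 * (t * (t - 1))"
      by (simp add: power2_eq_square algebra_simps)
    then have "a + (b - a) * t \<in> closed_segment a b \<longleftrightarrow> (b - a)\<^sup>2 * (t * (t - 1)) \<le> (b - a)\<^sup>2 * 0"
      unfolding mem_closed_segment_real_iff by (simp only: mult_zero_right)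
    also have "\<dots> \<longleftrightarrow> t * (t - 1) \<le> 0"
      using \<open>a \<noteq> b\<close> by (intro mult_le_cancel_left_pos) simp
    also have "\<dots> \<longleftrightarrow> t \<in> {0..1}"
      using mem_closed_segment_real_iff[of t 0 1] unfolding closed_segment_eq_real_ivl by simp
    finally show ?thesis .
  qed
  have "continuous_on {0..1} (\<lambda>t. f (a + t * (b - a)))"
    using mem by (intro continuous_on_compose2[OF f] continuous_intros) (simp add: mult.commute image_subset_iff)
  then have "set_integrable lborel {0..1} (\<lambda>t. f (a + t * (b - a)))"
    by (rule borel_integrable_atLeastAtMost')
  moreover have ind: "indicator (closed_segment a b) (a + (b - a) * t) = (indicator {0..1} t :: real)" for t
    using mem[of t] by (simp only: indicator_def)
  have "(LINT x:closed_segment a b|lborel. f x) =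
      \<bar>b - a\<bar> * (LINT t:{0..1}|lborel. f (a + t * (b - a)))"
    unfolding set_lebesgue_integral_def
    using \<open>a \<noteq> b\<close>
    by (subst lborel_integral_real_affine[where c="b - a" and t=a])
       (simp_all add: ind mult.commute[of _ "b - a"])
  ultimately show ?thesis
    by (simp add: set_borel_integral_eq_integral)
qed

text \<open>Pointwise, \<open>k\<close> and \<open>exp (\<delta> * k) - 1\<close> never have
  opposite signs. Hence a nonnegative integral of \<open>k\<close> stays nonnegative when the weight
  is tilted towards larger \<open>k\<close>.\<close>

lemma integral_tilt_ge:
  fixes k w :: "real \<Rightarrow> real"
  assumes k: "continuous_on {a..b} k" and w: "continuous_on {a..b} w"
    and w_nonneg: "\<And>t. t \<in> {a..b} \<Longrightarrow> 0 \<le> w t" and "0 \<le> \<delta>"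
  shows "integral {a..b} (\<lambda>t. k t * w t) \<le> integral {a..b} (\<lambda>t. k t * (exp (\<delta> * k t) * w t))"
proof (rule integral_le)
  show "(\<lambda>t. k t * w t) integrable_on {a..b}"
    by (intro integrable_continuous_real continuous_intros k w)
  show "(\<lambda>t. k t * (exp (\<delta> * k t) * w t)) integrable_on {a..b}"
    by (intro integrable_continuous_real continuous_intros k w)
  fix t assume t: "t \<in> {a..b}"
  have "0 \<le> k t * (exp (\<delta> * k t) - 1)"
    using \<open>0 \<le> \<delta>\<close> by (cases "0 \<le> k t") (simp_all add: mult_nonpos_nonpos mult_nonneg_nonpos)
  from mult_right_mono[OF this w_nonneg[OF t]]
  show "k t * w t \<le> k t * (exp (\<delta> * k t) * w t)"
    by (simp add: algebra_simps)
qed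

section \<open>The gap function and its zero\<close>

text \<open>
  With \<open>z\<close> the threshold after non-disclosure and \<open>X\<close> the one after disclosing \<open>y\<close>, the gain from
  disclosing is a positive multiple of \<open>(X - z) * gap q \<rho> c z X\<close>. Here \<open>q\<close> is the precision of
  \<open>x|y\<close>, the distance from \<open>X\<close> to the mean of \<open>x|y\<close> is \<open>\<rho> * X\<close>, and \<open>c\<close> is the distance from \<open>X\<close> to
  the sender's preferred threshold.
\<close>

definition gap :: "real \<Rightarrow> real \<Rightarrow> real \<Rightarrow> real \<Rightarrow> real \<Rightarrow> real" where
  "gap q \<rho> c z X =
     integral {0..1} (\<lambda>t. ((X - z) * t - c) * exp (- q * ((X - z) * t - \<rho> * X)\<^sup>2 / 2))"

text \<open>Reflecting all thresholds at 0 turns the case of negative \<open>c\<close>, that is of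
  negative \<open>r\<close>, into the positive one.\<close>

lemma gap_uminus: "gap q \<rho> (- c) (- z) (- X) = - gap q \<rho> c z X"
proof -
  have "((- X - - z) * t - - c) * exp (- q * ((- X - - z) * t - \<rho> * (- X))\<^sup>2 / 2) =
      - (((X - z) * t - c) * exp (- q * ((X - z) * t - \<rho> * X)\<^sup>2 / 2))" for t
  proof -
    have "(- X - - z) * t - \<rho> * (- X) = - ((X - z) * t - \<rho> * X)"
         "(- X - - z) * t - - c = - ((X - z) * t - c)"
      by (simp_all add: algebra_simps)
    then show ?thesis
      by (metis power2_minus mult_minus_left)
  qed
  then show ?thesis
    unfolding gap_def by (simp only: integral_neg)
qed

lemma continuous_on_gap: "continuous_on A (\<lambda>v. gap q \<rho> c (fst v) (snd v))"
proof -
  have "continuous_on UNIV (\<lambda>v. integral (cbox 0 1) (\<lambda>t. ((snd v - fst v) * t - c) *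
      exp (- q * ((snd v - fst v) * t - \<rho> * snd v)\<^sup>2 / 2)))"
    by (rule integral_continuous_on_param)
       (auto simp: case_prod_beta intro!: continuous_intros)
  then show ?thesis
    unfolding gap_def by (auto intro: continuous_on_subset)
qed

text \<open>After substituting \<open>u = (X - z) * t\<close> the affine factor no longer involves
  \<open>X\<close>: only the Gaussian weight and the upper limit move with it.\<close>

lemma gap_rescale:
  assumes "z < X"
  shows "(X - z) * gap q \<rho> c z X =
    integral {0..X - z} (\<lambda>u. (u - c) * exp (- q * (u - \<rho> * X)\<^sup>2 / 2))"
proof -
  let ?f = "\<lambda>u. (u - c) * exp (- q * (u - \<rho> * X)\<^sup>2 / 2)"
  have cont: "continuous_on {0..X - z} ?f"
    by (intro continuous_intros) auto
  have seg: "closed_segment 0 (X - z) = {0..X - z}"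
    using assms by (simp add: closed_segment_eq_real_ivl)
  have "integral {0..X - z} ?f = (LINT u:{0..X - z}|lborel. ?f u)"
    by (rule set_borel_integral_eq_integral(2)[symmetric], rule borel_integrable_atLeastAtMost'[OF cont])
  also have "\<dots> = \<bar>X - z - 0\<bar> * integral {0..1} (\<lambda>t. ?f (0 + t * (X - z - 0)))"
    using cont assms
    by (subst seg[symmetric], subst set_lebesgue_integral_closed_segment) (auto simp: seg)
  finally show ?thesis
    using assms by (simp add: gap_def mult.commute)
qed

text \<open>The affine factor is negative throughout the open unit interval, since
  \<open>(X - z) * t\<close> stays below \<open>c\<close>.\<close>

lemma gap_neg:
  assumes "0 < c" "X - z < c"
  shows "gap q \<rho> c z X < 0"
proof -
  have "gap q \<rho> c z X < integral {0..1} (\<lambda>t::real. 0::real)"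
    unfolding gap_def
  proof (rule integral_less_real)
    fix t :: real assume t: "t \<in> {0<..<1}"
    have "(X - z) * t < c"
    proof (cases "0 \<le> X - z")
      case True
      then have "(X - z) * t \<le> X - z"
        using t by (simp add: mult_left_le)
      then show ?thesis using assms by simp
    next
      case False
      then have "(X - z) * t < 0"
        using t by (auto simp: mult_less_0_iff)
      then show ?thesis using assms by simp
    qed
    then show "((X - z) * t - c) * exp (- q * ((X - z) * t - \<rho> * X)\<^sup>2 / 2) < 0"
      by (simp add: mult_less_0_iff)
  qed (auto intro!: continuous_intros)
  then show ?thesis by simp
qed

text \<open>
  Replacing \<open>X\<close> by \<open>X'\<close> multiplies the weight at \<open>u\<close> by a constant times \<open>exp (\<delta> * (u - c))\<close> and extends
  the range of integration only to points \<open>u > c\<close>.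
\<close>

lemma gap_single_crossing:
  assumes "0 < q" "0 < \<rho>" "0 < c" "X < X'" "0 \<le> gap q \<rho> c z X"
  shows "0 < gap q \<rho> c z X'"
proof -
  \<comment> \<open>Contraposition of \<open>gap_neg\<close>. Hence \<open>z < X\<close>, so
    rescaling applies, and the points added to the range lie beyond \<open>c\<close>.\<close>
  have w: "c \<le> X - z"
    using gap_neg[OF \<open>0 < c\<close>, of X z q \<rho>] assms by force
  define E where "E = (\<lambda>Y u. exp (- q * (u - \<rho> * Y)\<^sup>2 / 2))"
  define \<delta> where "\<delta> = q * \<rho> * (X' - X)"
  define C where "C = exp (\<delta> * c - q * \<rho>\<^sup>2 * (X'\<^sup>2 - X\<^sup>2) / 2)"
  have E: "E X' u = C * (exp (\<delta> * (u - c)) * E X u)" for u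
    unfolding E_def C_def \<delta>_def exp_add[symmetric]
    by (simp add: power2_eq_square algebra_simps diff_divide_distrib add_divide_distrib)
  have int: "(\<lambda>u. (u - c) * E Y u) integrable_on {a..b}" for a b Y
    unfolding E_def by (intro integrable_continuous_real continuous_intros) auto
  have "0 \<le> C * ((X - z) * gap q \<rho> c z X)"
    using w assms by (simp add: C_def)
  also have "\<dots> = C * integral {0..X - z} (\<lambda>u. (u - c) * E X u)"
    using w assms by (subst gap_rescale) (auto simp: E_def)
  also have "\<dots> \<le> C * integral {0..X - z} (\<lambda>u. (u - c) * (exp (\<delta> * (u - c)) * E X u))"
    using assms unfolding E_def
    by (intro mult_left_mono integral_tilt_ge continuous_intros) (auto simp: \<delta>_def C_def)
  also have "\<dots> = integral {0..X - z} (\<lambda>u. (u - c) * E X' u)"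
    unfolding E integral_mult_right[symmetric] by (simp add: mult.left_commute)
  finally have 1: "0 \<le> integral {0..X - z} (\<lambda>u. (u - c) * E X' u)" .
  \<comment> \<open>Tilting gives only a weak inequality; strictness comes from the added range, in
    whose interior \<open>u > c\<close>.\<close>
  have "integral {X - z..X' - z} (\<lambda>u::real. 0::real) < integral {X - z..X' - z} (\<lambda>u. (u - c) * E X' u)"
    using w assms unfolding E_def
    by (intro integral_less_real continuous_intros) auto
  then have "0 < integral {0..X' - z} (\<lambda>u. (u - c) * E X' u)"
    using 1 Henstock_Kurzweil_Integration.integral_combine[of 0 "X - z" "X' - z" "\<lambda>u. (u - c) * E X' u"] int w assms by simp
  also have "\<dots> = (X' - z) * gap q \<rho> c z X'"
    unfolding E_def by (rule gap_rescale[symmetric]) (use w assms in linarith)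
  finally show ?thesis
    using zero_less_mult_pos w assms by force
qed

text \<open>The range \<open>[0, X - z]\<close> ends no later than the peak
  \<open>\<rho> * X\<close> of the weight, so the weight increases along it. Replacing the weight by
  its value at the zero \<open>c\<close> of the affine factor lowers the integrand on both sides of
  \<open>c\<close>, and leaves a positive multiple of \<open>(X - z) / 2 - c\<close>.\<close>

lemma gap_pos:
  assumes "0 < q" "0 < c" "2 * c < X - z" "X - z \<le> \<rho> * X"
  shows "0 < gap q \<rho> c z X"
proof -
  define w where "w = X - z"
  define C where "C = exp (- q * (c - \<rho> * X)\<^sup>2 / 2)"
  have w: "2 * c < w" "w \<le> \<rho> * X"
    using assms by (auto simp: w_def)
  have "((\<lambda>t. w * t - c) has_integral (w * 1\<^sup>2 / 2 - c * 1 - (w * 0\<^sup>2 / 2 - c * 0))) {0..1}"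
    by (rule fundamental_theorem_of_calculus)
       (auto intro!: derivative_eq_intros simp: has_real_derivative_iff_has_vector_derivative[symmetric])
  then have "integral {0..1} (\<lambda>t. w * t - c) = w / 2 - c"
    by (simp add: integral_unique)
  then have "0 < integral {0..1} (\<lambda>t. (w * t - c) * C)"
    using w by (simp add: C_def)
  also have "\<dots> \<le> gap q \<rho> c z X"
    unfolding gap_def w_def[symmetric]
  proof (rule integral_le)
    fix t :: real assume t: "t \<in> {0..1}"
    define u where "u = w * t"
    have u: "0 \<le> u" "u \<le> w"
      using t w assms by (auto simp: u_def mult_left_le)
    have mono: "- q * (v - \<rho> * X)\<^sup>2 / 2 \<le> - q * (v' - \<rho> * X)\<^sup>2 / 2" if "v \<le> v'" "v' \<le> w" for v v'
    proof -
      have "(v' - \<rho> * X)\<^sup>2 \<le> (v - \<rho> * X)\<^sup>2"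
        unfolding abs_le_square_iff[symmetric] using that w by simp
      then show ?thesis using assms by simp
    qed
    show "(w * t - c) * C \<le> (w * t - c) * exp (- q * (w * t - \<rho> * X)\<^sup>2 / 2)"
    proof (cases "c \<le> u")
      case True
      then show ?thesis
        using mono[of c u] u unfolding C_def u_def[symmetric]
        by (intro mult_left_mono) auto
    next
      case False
      then show ?thesis
        using mono[of u c] w assms unfolding C_def u_def[symmetric]
        by (intro mult_left_mono_neg) auto
    qed
  qed (auto intro!: integrable_continuous_real continuous_intros)
  finally show ?thesis .
qed

text \<open>For \<open>c > 0\<close> and \<open>\<rho> > 1\<close> this value of \<open>X\<close>
  meets the hypotheses of \<open>gap_pos\<close>: the first three summands give
  \<open>2 * c < X - z\<close>, the last gives \<open>X - z \<le> \<rho> * X\<close>. It is even in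
  \<open>c\<close> and \<open>z\<close>, as reflection requires, and grows with the absolute value
  of \<open>z\<close>, hence is uniform on intervals.\<close>

definition gap_bound :: "real \<Rightarrow> real \<Rightarrow> real \<Rightarrow> real" where
  "gap_bound \<rho> c z = \<bar>z\<bar> + 2 * \<bar>c\<bar> + 1 + \<bar>z\<bar> / (\<rho> - 1)"

text \<open>\<open>gap\<close> is negative at \<open>X = z\<close> and positive at
  \<open>gap_bound\<close>; single crossing makes the zero in between the only one and fixes the
  sign on either side.\<close>

lemma gap_zero_pos:
  assumes "0 < q" "1 < \<rho>" "0 < c"
  shows "\<exists>R. \<bar>R\<bar> \<le> gap_bound \<rho> c z \<and> (\<forall>X. gap q \<rho> c z X = 0 \<longleftrightarrow> X = R) \<and>
    (\<forall>X. (X - z) * gap q \<rho> c z X \<le> 0 \<longleftrightarrow> X \<in> closed_segment R z)"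
proof -
  define B where "B = gap_bound \<rho> c z"
  have q: "\<bar>z\<bar> / (\<rho> - 1) \<ge> 0"
    using assms by simp
  have zB: "z + 2 * c < B"
    using q assms unfolding B_def gap_bound_def by linarith
  have "\<bar>z\<bar> / (\<rho> - 1) \<le> B"
    using assms unfolding B_def gap_bound_def by linarith
  then have "\<bar>z\<bar> \<le> B * (\<rho> - 1)"
    using assms by (simp add: pos_divide_le_eq)
  then have "0 < gap q \<rho> c z B"
    using zB assms by (intro gap_pos) (auto simp: algebra_simps)
  moreover have "gap q \<rho> c z z < 0"
    using assms by (intro gap_neg) auto
  moreover have "continuous_on {z..B} (gap q \<rho> c z)"
  proof -
    have "continuous_on {z..B} ((\<lambda>v. gap q \<rho> c (fst v) (snd v)) \<circ> Pair z)"
      by (intro continuous_on_compose continuous_on_gap continuous_intros)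
    then show ?thesis by (simp add: o_def)
  qed
  ultimately obtain R where R: "z \<le> R" "R \<le> B" "gap q \<rho> c z R = 0"
    using IVT'[of "gap q \<rho> c z" z 0 B] zB assms by force
  have up: "0 < gap q \<rho> c z X" if "R < X" for X
    using gap_single_crossing[of q \<rho> c R X z] that R assms by simp
  have down: "gap q \<rho> c z X < 0" if "X < R" for X
    using gap_single_crossing[of q \<rho> c X R z] that R assms by force
  have "R \<noteq> z"
    using gap_neg[of c z z q \<rho>] R assms by auto
  have "(X - z) * gap q \<rho> c z X \<le> 0 \<longleftrightarrow> X \<in> closed_segment R z" for X
    using up[of X] down[of X] R \<open>R \<noteq> z\<close>
    by (cases X R rule: linorder_cases)
       (auto simp: closed_segment_eq_real_ivl mult_le_0_iff)
  moreover have "gap q \<rho> c z X = 0 \<longleftrightarrow> X = R" for X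
    using up[of X] down[of X] R by (cases X R rule: linorder_cases) auto
  moreover have "- B \<le> z"
    using q assms unfolding B_def gap_bound_def by linarith
  ultimately show ?thesis
    using R unfolding B_def by (intro exI[of _ R]) auto
qed

lemma gap_zero:
  assumes "0 < q" "1 < \<rho>" "c \<noteq> 0"
  shows "\<exists>R. \<bar>R\<bar> \<le> gap_bound \<rho> c z \<and> (\<forall>X. gap q \<rho> c z X = 0 \<longleftrightarrow> X = R) \<and>
    (\<forall>X. (X - z) * gap q \<rho> c z X \<le> 0 \<longleftrightarrow> X \<in> closed_segment R z)"
proof (cases "0 < c")
  case True
  then show ?thesis using gap_zero_pos assms by simp
next
  case False
  then obtain R where R: "\<bar>R\<bar> \<le> gap_bound \<rho> (- c) (- z)"
    "\<And>X. gap q \<rho> (- c) (- z) X = 0 \<longleftrightarrow> X = R"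
    "\<And>X. (X - (- z)) * gap q \<rho> (- c) (- z) X \<le> 0 \<longleftrightarrow> X \<in> closed_segment R (- z)"
    using gap_zero_pos[of q \<rho> "- c" "- z"] assms by auto
  have "gap q \<rho> c z X = 0 \<longleftrightarrow> X = - R" for X
    using R(2)[of "- X"] by (auto simp: gap_uminus)
  moreover have "(X - z) * gap q \<rho> c z X \<le> 0 \<longleftrightarrow> X \<in> closed_segment (- R) z" for X
    using R(3)[of "- X"] unfolding gap_uminus mem_closed_segment_real_iff
    by (simp add: algebra_simps)
  ultimately show ?thesis
    using R(1) by (intro exI[of _ "- R"]) (auto simp: gap_bound_def)
qed

lemma gap_zero_continuous:
  assumes "0 < q" "1 < \<rho>" "c \<noteq> 0"
  obtains R where "continuous_on {l..u} R"
    and "\<And>z X. gap q \<rho> c z X = 0 \<longleftrightarrow> X = R z"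
    and "\<And>z X. (X - z) * gap q \<rho> c z X \<le> 0 \<longleftrightarrow> X \<in> closed_segment (R z) z"
proof -
  obtain R where R: "\<And>z. \<bar>R z\<bar> \<le> gap_bound \<rho> c z" "\<And>z X. gap q \<rho> c z X = 0 \<longleftrightarrow> X = R z"
    "\<And>z X. (X - z) * gap q \<rho> c z X \<le> 0 \<longleftrightarrow> X \<in> closed_segment (R z) z"
    using gap_zero[OF assms] by metis
  define B where "B = gap_bound \<rho> c (max \<bar>l\<bar> \<bar>u\<bar>)"
  have "R z \<in> {- B..B}" if "z \<in> {l..u}" for z
  proof -
    have "\<bar>z\<bar> \<le> \<bar>max \<bar>l\<bar> \<bar>u\<bar>\<bar>"
      using that by auto
    then have "gap_bound \<rho> c z \<le> B"
      using assms unfolding B_def gap_bound_def by (intro add_mono divide_right_mono) auto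
    then show ?thesis using R(1)[of z] by (simp add: abs_le_iff)
  qed
  moreover have "closed ((\<lambda>z. (z, R z)) ` {l..u})"
  proof -
    have "(\<lambda>z. (z, R z)) ` {l..u} = ({l..u} \<times> UNIV) \<inter> (\<lambda>v. gap q \<rho> c (fst v) (snd v)) -` {0}"
      using R(2) by auto
    then show ?thesis
      by (simp only:) (intro continuous_closed_preimage continuous_on_gap closed_Times, auto)
  qed
  ultimately have "continuous_on {l..u} R"
    \<comment> \<open>A closed graph yields continuity because the values stay in a compact
      interval; this is why \<open>z\<close> is confined to \<open>{l..u}\<close>.\<close>
    by (intro continuous_from_closed_graph[of "{- B..B}"]) auto
  then show ?thesis using R that by blast
qed

section \<open>Normal densities in terms of precisions\<close>

abbreviation normal_prec :: "real \<Rightarrow> real \<Rightarrow> real \<Rightarrow> real" where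
  "normal_prec \<tau> m \<equiv> normal_density m (1 / sqrt \<tau>)"

lemma normal_prec_eq:
  assumes "0 < \<tau>"
  shows "normal_prec \<tau> m x = sqrt (\<tau> / (2 * pi)) * exp (- \<tau> * (x - m)\<^sup>2 / 2)"
  using assms by (simp add: normal_density_def real_sqrt_divide power_divide field_simps)

lemma normal_prec_pos: "0 < \<tau> \<Longrightarrow> 0 < normal_prec \<tau> m x"
  by (simp add: normal_density_pos)

text \<open>Bayes' rule for normal laws: prior times likelihood is the marginal of the signal times
  the posterior, by completing the square in \<open>t\<close>. In the marginal the variances
  \<open>1 / a\<close> and \<open>1 / b\<close> add up, hence its precision.\<close>

lemma normal_prec_mult:
  assumes "0 < a" "0 < b"
  shows "normal_prec a m t * normal_prec b t s =
    normal_prec (a * b / (a + b)) m s * normal_prec (a + b) ((a * m + b * s) / (a + b)) t"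
proof -
  define M where "M = (a * m + b * s) / (a + b)"
  have pos: "0 < a + b" "0 < a * b / (a + b)"
    using assms by auto
  have "a * (t - m)\<^sup>2 + b * (s - t)\<^sup>2 = a * b / (a + b) * (s - m)\<^sup>2 + (a + b) * (t - M)\<^sup>2"
  proof -
    have "t - M = ((a + b) * t - (a * m + b * s)) / (a + b)"
      using pos by (simp add: M_def field_simps)
    then have "(a + b) * (t - M)\<^sup>2 = ((a + b) * t - (a * m + b * s))\<^sup>2 / (a + b)"
      using pos by (simp add: power2_eq_square)
    then show ?thesis
      using pos by (simp add: field_simps) (simp add: power2_eq_square algebra_simps)
  qed
  moreover have "- A / 2 + - B / 2 = - C / 2 + - D / 2" if "A + B = C + D" for A B C D :: real
    using that by simp
  ultimately have "exp (- a * (t - m)\<^sup>2 / 2) * exp (- b * (s - t)\<^sup>2 / 2) =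
      exp (- (a * b / (a + b)) * (s - m)\<^sup>2 / 2) * exp (- (a + b) * (t - M)\<^sup>2 / 2)"
    unfolding exp_add[symmetric] mult_minus_left by metis
  moreover have "sqrt (a / (2 * pi)) * sqrt (b / (2 * pi)) =
      sqrt (a * b / (a + b) / (2 * pi)) * sqrt ((a + b) / (2 * pi))"
  proof -
    have "a / k * (b / k) = a * b / l / k * (l / k)" if "0 < l" for k l :: real
      using that by simp
    from this[OF pos(1), of "2 * pi"] show ?thesis
      unfolding real_sqrt_mult[symmetric] by (rule arg_cong)
  qed
  moreover have "(u * v) * (u' * v') = (u * u') * (v * v')" for u v u' v' :: real
    by simp
  ultimately show ?thesis
    unfolding M_def[symmetric]
      normal_prec_eq[OF \<open>0 < a\<close>] normal_prec_eq[OF \<open>0 < b\<close>] normal_prec_eq[OF pos(1)] normal_prec_eq[OF pos(2)]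
    by (simp only:)
qed

text \<open>Shifting the mean of a Gaussian is an exponential tilt. The centre \<open>e\<close>
  affects only \<open>C\<close>; taking a mean for it later matches
  \<open>integral_tilt_ge\<close>.\<close>

lemma normal_prec_tilt:
  assumes "0 < h"
  obtains C where "0 < C" "\<And>y. normal_prec h M' y = C * (exp (h * (M' - M) * (y - e)) * normal_prec h M y)"
proof
  let ?C = "exp (h * (M' - M) * e - h * (M'\<^sup>2 - M\<^sup>2) / 2)"
  show "0 < ?C" by simp
  fix y
  have "exp (- h * (y - M')\<^sup>2 / 2) = ?C * (exp (h * (M' - M) * (y - e)) * exp (- h * (y - M)\<^sup>2 / 2))"
    unfolding exp_add[symmetric] by (simp add: power2_eq_square field_simps)
  then show "normal_prec h M' y = ?C * (exp (h * (M' - M) * (y - e)) * normal_prec h M y)"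
    using assms by (simp add: normal_prec_eq)
qed

lemma continuous_on_normal_prec:
  assumes "0 < \<tau>" "continuous_on A f" "continuous_on A g"
  shows "continuous_on A (\<lambda>x. normal_prec \<tau> (f x) (g x))"
  unfolding normal_prec_eq[OF \<open>0 < \<tau>\<close>] by (intro continuous_intros assms) auto

lemma measurable_normal_prec [measurable (raw)]:
  assumes [measurable]: "f \<in> borel_measurable N" "g \<in> borel_measurable N"
  shows "(\<lambda>x. normal_prec \<tau> (f x) (g x)) \<in> borel_measurable N"
  unfolding normal_density_def by measurable

lemma integrable_normal_prec_affine:
  assumes "0 < \<tau>"
  shows "integrable lborel (\<lambda>t. (u + v * t) * normal_prec \<tau> m t)"
    and "(\<integral>t. (u + v * t) * normal_prec \<tau> m t \<partial>lborel) = u + v * m"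
proof -
  have \<tau>: "0 < 1 / sqrt \<tau>" using assms by simp
  have eq: "(u + v * t) * normal_prec \<tau> m t = u * normal_prec \<tau> m t + v * (normal_prec \<tau> m t * t)" for t
    by (simp add: algebra_simps)
  show "integrable lborel (\<lambda>t. (u + v * t) * normal_prec \<tau> m t)"
    unfolding eq using \<tau> integrable_normal_moment_nz_1[OF \<tau>] by simp
  show "(\<integral>t. (u + v * t) * normal_prec \<tau> m t \<partial>lborel) = u + v * m"
    unfolding eq using \<tau> integrable_normal_moment_nz_1[OF \<tau>] integral_normal_moment_nz_1[OF \<tau>] by simp
qed

lemma integrable_bounded_normal_prec:
  assumes "0 < \<tau>" and [measurable]: "v \<in> borel_measurable borel" and v: "\<And>t. \<bar>v t\<bar> \<le> K"
  shows "integrable lborel (\<lambda>t. (u + w * t) * (v t * normal_prec \<tau> m t))"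
proof (rule Bochner_Integration.integrable_bound)
  show "integrable lborel (\<lambda>t. K * ((u + w * t) * normal_prec \<tau> m t))"
    using integrable_normal_prec_affine[OF \<open>0 < \<tau>\<close>] by simp
  show "AE t in lborel. norm ((u + w * t) * (v t * normal_prec \<tau> m t)) \<le>
      norm (K * ((u + w * t) * normal_prec \<tau> m t))"
  proof (intro always_eventually allI)
    fix t
    have "\<bar>v t\<bar> \<le> \<bar>K\<bar>" using v[of t] by linarith
    then have "\<bar>v t\<bar> * \<bar>(u + w * t) * normal_prec \<tau> m t\<bar> \<le> \<bar>K\<bar> * \<bar>(u + w * t) * normal_prec \<tau> m t\<bar>"
      by (rule mult_right_mono) simp
    then show "norm ((u + w * t) * (v t * normal_prec \<tau> m t)) \<le>
      norm (K * ((u + w * t) * normal_prec \<tau> m t))"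
      by (simp add: abs_mult mult_ac)
  qed
qed measurable

section \<open>Probabilities of sets of signals\<close>

definition signal_prob :: "real \<Rightarrow> real set \<Rightarrow> real \<Rightarrow> real" where
  "signal_prob \<tau> S \<theta> = (LINT s:S|lborel. normal_prec \<tau> \<theta> s)"

lemma measurable_signal_prob [measurable]:
  assumes [measurable]: "S \<in> sets borel"
  shows "signal_prob \<tau> S \<in> borel_measurable borel"
  unfolding signal_prob_def set_lebesgue_integral_def by measurable

lemma set_integrable_normal_prec:
  assumes "0 < \<tau>" "S \<in> sets borel"
  shows "set_integrable lborel S (normal_prec \<tau> m)"
  unfolding set_integrable_def using assms
  by (intro integrable_mult_indicator) auto

lemma signal_prob_eq_measure:
  assumes "0 < \<tau>" "S \<in> sets borel"
  shows "signal_prob \<tau> S \<theta> = measure (density lborel (normal_prec \<tau> \<theta>)) S"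
proof -
  have "emeasure (density lborel (normal_prec \<tau> \<theta>)) S =
      (\<integral>\<^sup>+ x. ennreal (indicator S x * normal_prec \<tau> \<theta> x) \<partial>lborel)"
    using assms by (subst emeasure_density) (auto intro!: nn_integral_cong simp: indicator_def)
  also have "\<dots> = ennreal (signal_prob \<tau> S \<theta>)"
    using set_integrable_normal_prec[OF assms, of \<theta>]
    unfolding signal_prob_def set_lebesgue_integral_def set_integrable_def
    by (subst nn_integral_eq_integral) auto
  finally show ?thesis
    unfolding measure_def signal_prob_def set_lebesgue_integral_def
    by (simp add: Bochner_Integration.integral_nonneg)
qed

lemma signal_prob_bounds:
  assumes "0 < \<tau>" "S \<in> sets borel"
  shows "0 \<le> signal_prob \<tau> S \<theta>" "signal_prob \<tau> S \<theta> \<le> 1"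
proof -
  interpret prob_space "density lborel (normal_prec \<tau> \<theta>)"
    using assms by (intro prob_space_normal_density) simp
  show "0 \<le> signal_prob \<tau> S \<theta>" "signal_prob \<tau> S \<theta> \<le> 1"
    by (simp_all add: signal_prob_eq_measure[OF assms])
qed

lemma cdf_x_complement:
  assumes "0 < \<beta>"
  shows "1 - cdf_x \<beta> x \<theta> = signal_prob \<beta> {x<..} \<theta>"
proof -
  interpret prob_space "density lborel (normal_prec \<beta> \<theta>)"
    using assms by (intro prob_space_normal_density) simp
  have "signal_prob \<beta> {x<..} \<theta> = prob (space (density lborel (normal_prec \<beta> \<theta>)) - {..x})"
    using assms by (subst signal_prob_eq_measure) (auto intro!: arg_cong[of _ _ prob])
  also have "\<dots> = 1 - prob {..x}"
    by (rule prob_compl) simp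
  finally show ?thesis
    by (simp add: cdf_x_def cdf_def signal_dens_def[abs_def])
qed

text \<open>Fubini and \<open>normal_prec_mult\<close>: for fixed \<open>s\<close> the inner
  integral over the state produces \<open>r\<close> plus a posterior mean. It serves the Sender,
  with \<open>S\<close> the private signals above a threshold, and the receivers, with
  \<open>S\<close> the concealed signals.\<close>

lemma integral_signal_prob:
  assumes "0 < a" "0 < b" and [measurable]: "S \<in> sets borel"
  shows "(\<integral>\<theta>. (r + \<theta>) * (signal_prob b S \<theta> * normal_prec a m \<theta>) \<partial>lborel) =
    (LINT s:S|lborel. (r + (a * m + b * s) / (a + b)) * normal_prec (a * b / (a + b)) m s)"
proof -
  define F where "F = (\<lambda>\<theta> s. indicator S s * ((r + \<theta>) * (normal_prec a m \<theta> * normal_prec b \<theta> s)))"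
  have F_eq: "F \<theta> s = (r + \<theta>) * normal_prec a m \<theta> * (indicator S s *\<^sub>R normal_prec b \<theta> s)" for \<theta> s
    by (simp add: F_def)
  have F_norm: "norm (F \<theta> s) = \<bar>r + \<theta>\<bar> * normal_prec a m \<theta> * (indicator S s *\<^sub>R normal_prec b \<theta> s)" for \<theta> s
    by (simp add: F_def abs_mult)
  have [measurable]: "case_prod F \<in> borel_measurable (lborel \<Otimes>\<^sub>M lborel)"
    unfolding F_def by measurable
  have "integrable (lborel \<Otimes>\<^sub>M lborel) (case_prod F)"
  proof (rule lborel_pair.Fubini_integrable)
    \<comment> \<open>Integrating the norm over \<open>s\<close> leaves a probability, at most 1,
      times an affine function times a Gaussian.\<close>
    have "(\<integral>s. norm (F \<theta> s) \<partial>lborel) = norm ((r + \<theta>) * (signal_prob b S \<theta> * normal_prec a m \<theta>))" for \<theta>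
      using signal_prob_bounds[OF \<open>0 < b\<close> \<open>S \<in> sets borel\<close>, of \<theta>]
      unfolding F_norm integral_mult_right_zero
      by (simp add: signal_prob_def set_lebesgue_integral_def abs_mult)
    moreover have "integrable lborel (\<lambda>\<theta>. (r + 1 * \<theta>) * (signal_prob b S \<theta> * normal_prec a m \<theta>))"
      using signal_prob_bounds[OF \<open>0 < b\<close> \<open>S \<in> sets borel\<close>] assms
      by (intro integrable_bounded_normal_prec[where K=1]) auto
    ultimately show "integrable lborel (\<lambda>\<theta>. \<integral>s. norm (case_prod F (\<theta>, s)) \<partial>lborel)"
      by (simp only: mult_1 case_prod_conv integrable_norm)
    show "AE \<theta> in lborel. integrable lborel (\<lambda>s. case_prod F (\<theta>, s))"
      using set_integrable_normal_prec[OF \<open>0 < b\<close> \<open>S \<in> sets borel\<close>]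
      unfolding F_eq set_integrable_def case_prod_conv
      by (intro always_eventually allI integrable_mult_right) auto
  qed measurable
  from lborel_pair.Fubini_integral[OF this]
  have "(\<integral>\<theta>. (\<integral>s. F \<theta> s \<partial>lborel) \<partial>lborel) = (\<integral>s. (\<integral>\<theta>. F \<theta> s \<partial>lborel) \<partial>lborel)" ..
  moreover have "(\<integral>s. F \<theta> s \<partial>lborel) = (r + \<theta>) * (signal_prob b S \<theta> * normal_prec a m \<theta>)" for \<theta>
    unfolding F_eq integral_mult_right_zero
    by (simp add: signal_prob_def set_lebesgue_integral_def)
  moreover have "(\<integral>\<theta>. F \<theta> s \<partial>lborel) =
      indicator S s *\<^sub>R ((r + (a * m + b * s) / (a + b)) * normal_prec (a * b / (a + b)) m s)" for s
  proof -
    have "F \<theta> s = indicator S s * normal_prec (a * b / (a + b)) m s *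
        ((r + 1 * \<theta>) * normal_prec (a + b) ((a * m + b * s) / (a + b)) \<theta>)" for \<theta>
      unfolding F_def normal_prec_mult[OF \<open>0 < a\<close> \<open>0 < b\<close>] by simp
    then have "(\<integral>\<theta>. F \<theta> s \<partial>lborel) =
        indicator S s * normal_prec (a * b / (a + b)) m s * (r + 1 * ((a * m + b * s) / (a + b)))"
      using integrable_normal_prec_affine(2)[of "a + b"] assms
      by (simp only: integral_mult_right_zero add_pos_pos)
    then show ?thesis by simp
  qed
  ultimately show ?thesis
    by (simp add: set_lebesgue_integral_def)
qed

section \<open>Truncated normal means\<close>

text \<open>The mean of a normal law with mean \<open>M\<close> and precision \<open>h\<close>,
  truncated to the segment; the common factor of numerator and denominator has been cancelled. In
  this form it also makes sense for \<open>a = b\<close>, with value \<open>a\<close>, and is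
  continuous in all of \<open>M\<close>, \<open>a\<close>, \<open>b\<close>.\<close>

definition segment_mean :: "real \<Rightarrow> real \<Rightarrow> real \<Rightarrow> real \<Rightarrow> real" where
  "segment_mean h M a b =
     integral {0..1} (\<lambda>t. (a + t * (b - a)) * normal_prec h M (a + t * (b - a))) /
     integral {0..1} (\<lambda>t. normal_prec h M (a + t * (b - a)))"

lemma integral_normal_prec_segment_pos:
  assumes "0 < h"
  shows "0 < integral {0..1} (\<lambda>t. normal_prec h M (a + t * (b - a)))"
proof -
  have "integral {0..1} (\<lambda>t::real. 0::real) < integral {0..1} (\<lambda>t. normal_prec h M (a + t * (b - a)))"
    using assms
    by (intro integral_less_real continuous_on_normal_prec continuous_intros)
       (auto simp: normal_prec_pos)
  then show ?thesis by simp
qed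

lemma integral_affine_normal_prec_segment:
  assumes "0 < h"
  shows "integral {0..1} (\<lambda>t. (u + v * (a + t * (b - a))) * normal_prec h M (a + t * (b - a))) =
    (u + v * segment_mean h M a b) * integral {0..1} (\<lambda>t. normal_prec h M (a + t * (b - a)))"
proof -
  let ?y = "\<lambda>t. a + t * (b - a)"
  have "(\<lambda>t. normal_prec h M (?y t)) integrable_on {0..1}"
    "(\<lambda>t. ?y t * normal_prec h M (?y t)) integrable_on {0..1}"
    using assms
    by (intro integrable_continuous_real continuous_on_normal_prec continuous_intros; simp)+
  then have "integral {0..1} (\<lambda>t. u * normal_prec h M (?y t) + v * (?y t * normal_prec h M (?y t))) =
      u * integral {0..1} (\<lambda>t. normal_prec h M (?y t)) +
      v * integral {0..1} (\<lambda>t. ?y t * normal_prec h M (?y t))"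
    by (subst Henstock_Kurzweil_Integration.integral_add) (auto intro!: integrable_on_mult_right)
  also have "\<dots> = (u + v * segment_mean h M a b) * integral {0..1} (\<lambda>t. normal_prec h M (?y t))"
    using integral_normal_prec_segment_pos[OF assms, of M a b]
    by (simp add: segment_mean_def field_simps)
  finally show ?thesis
    by (simp add: algebra_simps)
qed

text \<open>Raising \<open>M\<close> tilts the weight upwards. With the old mean \<open>e\<close> as
  centre, the integral of \<open>y - e\<close> is zero before the tilt and so nonnegative after
  it.\<close>

lemma segment_mean_mono:
  assumes "0 < h" "M \<le> M'"
  shows "segment_mean h M a b \<le> segment_mean h M' a b"
proof -
  define e where "e = segment_mean h M a b"
  let ?y = "\<lambda>t. a + t * (b - a)"
  obtain C where C: "0 < C"
    "\<And>y. normal_prec h M' y = C * (exp (h * (M' - M) * (y - e)) * normal_prec h M y)"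
    using normal_prec_tilt[OF \<open>0 < h\<close>] by blast
  have "0 = C * integral {0..1} (\<lambda>t. (- e + 1 * ?y t) * normal_prec h M (?y t))"
    unfolding integral_affine_normal_prec_segment[OF \<open>0 < h\<close>] by (simp add: e_def)
  also have "\<dots> = C * integral {0..1} (\<lambda>t. (?y t - e) * normal_prec h M (?y t))"
    by simp
  also have "\<dots> \<le> C * integral {0..1} (\<lambda>t. (?y t - e) *
      (exp (h * (M' - M) * (?y t - e)) * normal_prec h M (?y t)))"
    using assms C(1)
    by (intro mult_left_mono integral_tilt_ge continuous_on_normal_prec continuous_intros) auto
  also have "\<dots> = integral {0..1} (\<lambda>t. (- e + 1 * ?y t) * normal_prec h M' (?y t))"
    unfolding C(2) integral_mult_right[symmetric] by (simp add: mult.left_commute)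
  also have "\<dots> = (segment_mean h M' a b - e) * integral {0..1} (\<lambda>t. normal_prec h M' (?y t))"
    unfolding integral_affine_normal_prec_segment[OF \<open>0 < h\<close>] by simp
  finally show ?thesis
    using integral_normal_prec_segment_pos[OF \<open>0 < h\<close>, of M' a b]
    by (simp add: e_def zero_le_mult_iff)
qed

lemma continuous_on_segment_mean:
  assumes "0 < h" "continuous_on A M" "continuous_on A a" "continuous_on A b"
  shows "continuous_on A (\<lambda>z. segment_mean h (M z) (a z) (b z))"
proof -
  let ?y = "\<lambda>(v::real\<times>real\<times>real) t. fst (snd v) + t * (snd (snd v) - fst (snd v))"
  have "continuous_on UNIV (\<lambda>v. integral (cbox 0 1) (\<lambda>t. ?y v t * normal_prec h (fst v) (?y v t)))"
    by (rule integral_continuous_on_param)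
       (auto simp: case_prod_beta intro!: continuous_intros continuous_on_normal_prec assms(1))
  moreover have "continuous_on UNIV (\<lambda>v. integral (cbox 0 1) (\<lambda>t. normal_prec h (fst v) (?y v t)))"
    by (rule integral_continuous_on_param)
       (auto simp: case_prod_beta intro!: continuous_intros continuous_on_normal_prec assms(1))
  ultimately have "continuous_on UNIV (\<lambda>v. segment_mean h (fst v) (fst (snd v)) (snd (snd v)))"
    unfolding segment_mean_def
    using integral_normal_prec_segment_pos[OF \<open>0 < h\<close>]
    by (intro continuous_on_divide) (auto simp: less_imp_neq[THEN not_sym])
  from continuous_on_compose2[OF this, of A "\<lambda>z. (M z, a z, b z)"] assms
  show ?thesis by (simp add: continuous_on_Pair)
qed

section \<open>Conditional densities and payoffs\<close>

context
  fixes \<alpha> \<beta> \<gamma> \<mu> :: real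
  assumes pos: "0 < \<alpha>" "0 < \<beta>" "0 < \<gamma>"
begin

lemma dens_state_signal_eq:
  assumes "0 < \<tau>"
  shows "dens_state_signal \<tau> \<gamma> \<mu> s \<theta> = normal_prec (\<gamma> + \<tau>) ((\<gamma> * \<mu> + \<tau> * s) / (\<gamma> + \<tau>)) \<theta>"
proof -
  have "0 < 1 / sqrt (\<gamma> + \<tau>)" "0 < \<gamma> * \<tau> / (\<gamma> + \<tau>)"
    using pos assms by auto
  then show ?thesis
    using normal_prec_pos[of "\<gamma> * \<tau> / (\<gamma> + \<tau>)" \<mu> s]
    unfolding dens_state_signal_def prior_dens_def signal_dens_def
      normal_prec_mult[OF \<open>0 < \<gamma>\<close> \<open>0 < \<tau>\<close>] integral_mult_right_zero
    by simp
qed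

abbreviation x_mean :: "real \<Rightarrow> real" where
  "x_mean x \<equiv> (\<gamma> * \<mu> + \<beta> * x) / (\<gamma> + \<beta>)"

abbreviation xy_mean :: "real \<Rightarrow> real \<Rightarrow> real" where
  "xy_mean x y \<equiv> (\<gamma> * \<mu> + \<beta> * x + \<alpha> * y) / (\<gamma> + \<beta> + \<alpha>)"

text \<open>Given \<open>x\<close>, the signal \<open>y\<close> has variance
  \<open>1 / (\<gamma> + \<beta>) + 1 / \<alpha>\<close>; this is its reciprocal.\<close>

abbreviation y_prec :: real where
  "y_prec \<equiv> (\<gamma> + \<beta>) * \<alpha> / (\<gamma> + \<beta> + \<alpha>)"

lemma y_prec_pos: "0 < y_prec"
  using pos by simp

text \<open>Two successive updates, first on \<open>x\<close>, then on \<open>y\<close> with the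
  posterior given \<open>x\<close> as the new prior. The factors are the densities of
  \<open>x\<close>, of \<open>y\<close> given \<open>x\<close>, and of the state given both.\<close>

lemma joint_dens_eq:
  "joint_dens \<alpha> \<beta> \<gamma> \<mu> \<theta> x y =
    normal_prec (\<gamma> * \<beta> / (\<gamma> + \<beta>)) \<mu> x * normal_prec y_prec (x_mean x) y *
    normal_prec (\<gamma> + \<beta> + \<alpha>) (xy_mean x y) \<theta>"
proof -
  have "(\<gamma> + \<beta>) * x_mean x = \<gamma> * \<mu> + \<beta> * x"
    using pos by simp
  moreover have "0 < \<gamma> + \<beta>"
    using pos by simp
  ultimately show ?thesis
    using normal_prec_mult[OF pos(3,2), of \<mu> \<theta> x] normal_prec_mult[OF _ pos(1), of "\<gamma> + \<beta>" "x_mean x" \<theta> y]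
    unfolding joint_dens_def prior_dens_def signal_dens_def
    by (simp only: mult.assoc)
qed

lemma joint_dens_integral:
  "(\<integral>t. joint_dens \<alpha> \<beta> \<gamma> \<mu> t x y \<partial>lborel) =
    normal_prec (\<gamma> * \<beta> / (\<gamma> + \<beta>)) \<mu> x * normal_prec y_prec (x_mean x) y"
  using pos unfolding joint_dens_eq integral_mult_right_zero by simp

lemma dens_state_xy_eq:
  "dens_state_xy \<alpha> \<beta> \<gamma> \<mu> x y \<theta> = normal_prec (\<gamma> + \<beta> + \<alpha>) (xy_mean x y) \<theta>"
  using pos normal_prec_pos[of "\<gamma> * \<beta> / (\<gamma> + \<beta>)" \<mu> x] normal_prec_pos[OF y_prec_pos, of "x_mean x" y]
  unfolding dens_state_xy_def joint_dens_integral unfolding joint_dens_eq by simp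

lemma dens_y_state_x_eq: "dens_y_state_x \<alpha> \<beta> \<gamma> \<mu> \<theta> x y = normal_prec \<alpha> \<theta> y"
  using pos normal_prec_pos[of \<gamma> \<mu> \<theta>] normal_prec_pos[of \<beta> \<theta> x]
  unfolding dens_y_state_x_def joint_dens_def prior_dens_def signal_dens_def integral_mult_right_zero
  by simp

lemma dens_y_x_eq: "dens_y_x \<alpha> \<beta> \<gamma> \<mu> x y = normal_prec y_prec (x_mean x) y"
  using pos normal_prec_pos[of "\<gamma> * \<beta> / (\<gamma> + \<beta>)" \<mu> x]
  unfolding dens_y_x_def joint_dens_integral prior_dens_def signal_dens_def
    normal_prec_mult[OF pos(3,2)] integral_mult_right_zero
  by simp

section \<open>Beliefs after non-disclosure\<close>

lemma dens_nondisclosure_eq: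
  "dens_nondisclosure \<alpha> \<beta> \<gamma> \<mu> p Y x \<theta> =
    (1 - p + p * (signal_prob \<alpha> Y \<theta> / signal_prob y_prec Y (x_mean x))) *
    normal_prec (\<gamma> + \<beta>) (x_mean x) \<theta>"
  using pos unfolding dens_nondisclosure_def dens_y_state_x_eq dens_y_x_eq
  by (simp add: dens_state_signal_eq signal_prob_def)

lemma nondisclosure_weight_bound:
  assumes "Y \<in> sets borel"
  obtains K where "\<And>\<theta>. \<bar>1 - p + p * (signal_prob \<alpha> Y \<theta> / D)\<bar> \<le> K"
proof
  fix \<theta>
  have "\<bar>signal_prob \<alpha> Y \<theta>\<bar> \<le> 1"
    using signal_prob_bounds[OF pos(1) assms, of \<theta>] by simp
  then have "\<bar>p / D\<bar> * \<bar>signal_prob \<alpha> Y \<theta>\<bar> \<le> \<bar>p / D\<bar>"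
    by (intro mult_left_le) simp_all
  then have "\<bar>p * (signal_prob \<alpha> Y \<theta> / D)\<bar> \<le> \<bar>p / D\<bar>"
    by (simp add: abs_mult)
  then show "\<bar>1 - p + p * (signal_prob \<alpha> Y \<theta> / D)\<bar> \<le> \<bar>1 - p\<bar> + \<bar>p / D\<bar>"
    by linarith
qed

text \<open>The mean given both signals is affine in \<open>y\<close>, so averaging it over the
  concealed signals amounts to evaluating it at their truncated mean.\<close>

lemma nondisclosure_mean_closed_segment:
  assumes "a \<noteq> b"
  shows "nondisclosure_mean \<alpha> \<beta> \<gamma> \<mu> p (closed_segment a b) x =
    (1 - p) * x_mean x + p * xy_mean x (segment_mean y_prec (x_mean x) a b)"
proof -
  let ?S = "closed_segment a b" and ?M = "x_mean x"
  define W where "W = integral {0..1} (\<lambda>t. normal_prec y_prec ?M (a + t * (b - a)))"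
  have W: "0 < W"
    unfolding W_def by (rule integral_normal_prec_segment_pos[OF y_prec_pos])
  have S [measurable]: "?S \<in> sets borel"
    by (simp add: borel_closed)
  have \<gamma>\<beta>: "0 < \<gamma> + \<beta>"
    using pos by simp
  then have M: "(\<gamma> + \<beta>) * ?M = \<gamma> * \<mu> + \<beta> * x"
    by simp
  define D where "D = signal_prob y_prec ?S ?M"
  \<comment> \<open>As \<open>a \<noteq> b\<close>, this is positive, so the quotient in the
    posterior is a genuine one and \<open>D\<close> cancels at the end.\<close>
  have D: "D = \<bar>b - a\<bar> * W"
    unfolding D_def W_def signal_prob_def
    using assms y_prec_pos
    by (intro set_lebesgue_integral_closed_segment continuous_on_normal_prec continuous_intros) auto
  have 1: "integrable lborel (\<lambda>\<theta>. (0 + 1 * \<theta>) * normal_prec (\<gamma> + \<beta>) ?M \<theta>)"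
    "(\<integral>\<theta>. (0 + 1 * \<theta>) * normal_prec (\<gamma> + \<beta>) ?M \<theta> \<partial>lborel) = 0 + 1 * ?M"
    using integrable_normal_prec_affine[OF \<gamma>\<beta>] by blast+
  have 2: "integrable lborel (\<lambda>\<theta>. (0 + 1 * \<theta>) * (signal_prob \<alpha> ?S \<theta> * normal_prec (\<gamma> + \<beta>) ?M \<theta>))"
    using signal_prob_bounds[OF pos(1) S] \<gamma>\<beta>
    by (intro integrable_bounded_normal_prec[where K=1]) auto
  have "nondisclosure_mean \<alpha> \<beta> \<gamma> \<mu> p ?S x =
      (\<integral>\<theta>. (1 - p) * ((0 + 1 * \<theta>) * normal_prec (\<gamma> + \<beta>) ?M \<theta>) +
        p / D * ((0 + 1 * \<theta>) * (signal_prob \<alpha> ?S \<theta> * normal_prec (\<gamma> + \<beta>) ?M \<theta>)) \<partial>lborel)"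
    unfolding nondisclosure_mean_def dens_nondisclosure_eq D_def[symmetric]
    by (intro Bochner_Integration.integral_cong) (auto simp: algebra_simps)
  also have "\<dots> = (1 - p) * ?M +
      p / D * (\<integral>\<theta>. (0 + \<theta>) * (signal_prob \<alpha> ?S \<theta> * normal_prec (\<gamma> + \<beta>) ?M \<theta>) \<partial>lborel)"
    using 1 2 by simp
  also have "(\<integral>\<theta>. (0 + \<theta>) * (signal_prob \<alpha> ?S \<theta> * normal_prec (\<gamma> + \<beta>) ?M \<theta>) \<partial>lborel) =
      (LINT y:?S|lborel. (0 + ((\<gamma> + \<beta>) * ?M + \<alpha> * y) / (\<gamma> + \<beta> + \<alpha>)) * normal_prec y_prec ?M y)"
    by (rule integral_signal_prob[OF \<gamma>\<beta> pos(1) S])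
  also have "\<dots> = (LINT y:?S|lborel. ((\<gamma> * \<mu> + \<beta> * x) / (\<gamma> + \<beta> + \<alpha>) + \<alpha> / (\<gamma> + \<beta> + \<alpha>) * y) *
      normal_prec y_prec ?M y)"
    unfolding M by (simp add: add_divide_distrib)
  also have "\<dots> = \<bar>b - a\<bar> * (((\<gamma> * \<mu> + \<beta> * x) / (\<gamma> + \<beta> + \<alpha>) +
      \<alpha> / (\<gamma> + \<beta> + \<alpha>) * segment_mean y_prec ?M a b) * W)"
    unfolding W_def integral_affine_normal_prec_segment[OF y_prec_pos, symmetric]
    using assms y_prec_pos
    by (intro set_lebesgue_integral_closed_segment continuous_on_normal_prec continuous_intros) auto
  also have "\<dots> = D * xy_mean x (segment_mean y_prec ?M a b)"
    unfolding D by (simp add: add_divide_distrib)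
  finally show ?thesis
    using D W assms by simp
qed

text \<open>Strictness comes from the uninformed part, whose weight \<open>1 - p\<close> is
  positive; for the concealment part weak monotonicity suffices.\<close>

lemma nondisclosure_mean_less:
  assumes "a \<noteq> b" "p < 1" "0 \<le> p" "x < x'"
  shows "nondisclosure_mean \<alpha> \<beta> \<gamma> \<mu> p (closed_segment a b) x <
    nondisclosure_mean \<alpha> \<beta> \<gamma> \<mu> p (closed_segment a b) x'"
proof -
  have "x_mean x < x_mean x'"
    using assms pos by (simp add: divide_strict_right_mono)
  moreover from this have "segment_mean y_prec (x_mean x) a b \<le> segment_mean y_prec (x_mean x') a b"
    by (intro segment_mean_mono y_prec_pos) simp
  then have "xy_mean x (segment_mean y_prec (x_mean x) a b) \<le> xy_mean x' (segment_mean y_prec (x_mean x') a b)"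
    using assms pos by (intro divide_right_mono add_mono mult_left_mono) auto
  ultimately show ?thesis
    using assms unfolding nondisclosure_mean_closed_segment[OF \<open>a \<noteq> b\<close>]
    by (intro add_less_le_mono mult_strict_left_mono mult_left_mono) auto
qed

section \<open>The Sender's payoff as a function of the threshold\<close>

text \<open>With the state integrated out first, the threshold enters only through the range of
  integration; the integrand is \<open>r\<close> plus the mean of the state given \<open>s\<close>
  and \<open>y\<close>, times the density of \<open>s\<close> given \<open>y\<close>.\<close>

lemma sender_payoff_eq:
  "sender_payoff \<alpha> \<beta> \<gamma> \<mu> r x y =
    (LINT s:{x<..}|lborel. (r + (\<gamma> * \<mu> + \<alpha> * y + \<beta> * s) / (\<gamma> + \<alpha> + \<beta>)) *
      normal_prec ((\<gamma> + \<alpha>) * \<beta> / (\<gamma> + \<alpha> + \<beta>)) ((\<gamma> * \<mu> + \<alpha> * y) / (\<gamma> + \<alpha>)) s)"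
proof -
  have \<gamma>\<alpha>: "0 < \<gamma> + \<alpha>"
    using pos by simp
  have "sender_payoff \<alpha> \<beta> \<gamma> \<mu> r x y = (\<integral>\<theta>. (r + \<theta>) * (signal_prob \<beta> {x<..} \<theta> *
      normal_prec (\<gamma> + \<alpha>) ((\<gamma> * \<mu> + \<alpha> * y) / (\<gamma> + \<alpha>)) \<theta>) \<partial>lborel)"
    unfolding sender_payoff_def cdf_x_complement[OF pos(2)] dens_state_signal_eq[OF pos(1)]
    by (simp add: mult.assoc)
  then show ?thesis
    using integral_signal_prob[OF \<gamma>\<alpha> pos(2), of "{x<..}" r] \<gamma>\<alpha> by simp
qed

lemma sender_payoff_diff_less:
  assumes "x1 < x2"
  shows "sender_payoff \<alpha> \<beta> \<gamma> \<mu> r x1 y - sender_payoff \<alpha> \<beta> \<gamma> \<mu> r x2 y =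
    (LINT s:closed_segment x1 x2|lborel. (r + (\<gamma> * \<mu> + \<alpha> * y + \<beta> * s) / (\<gamma> + \<alpha> + \<beta>)) *
      normal_prec ((\<gamma> + \<alpha>) * \<beta> / (\<gamma> + \<alpha> + \<beta>)) ((\<gamma> * \<mu> + \<alpha> * y) / (\<gamma> + \<alpha>)) s)"
proof -
  define q where "q = (\<gamma> + \<alpha>) * \<beta> / (\<gamma> + \<alpha> + \<beta>)"
  define F where "F = (\<lambda>s. (r + (\<gamma> * \<mu> + \<alpha> * y + \<beta> * s) / (\<gamma> + \<alpha> + \<beta>)) *
      normal_prec q ((\<gamma> * \<mu> + \<alpha> * y) / (\<gamma> + \<alpha>)) s)"
  have "0 < q"
    using pos by (simp add: q_def)
  have "F = (\<lambda>s. (r + (\<gamma> * \<mu> + \<alpha> * y) / (\<gamma> + \<alpha> + \<beta>) + \<beta> / (\<gamma> + \<alpha> + \<beta>) * s) *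
      normal_prec q ((\<gamma> * \<mu> + \<alpha> * y) / (\<gamma> + \<alpha>)) s)"
    by (simp add: F_def fun_eq_iff add_divide_distrib)
  then have F_int: "integrable lborel F"
    by (simp only:) (rule integrable_normal_prec_affine(1)[OF \<open>0 < q\<close>])
  have int: "set_integrable lborel S F" if "S \<in> sets borel" for S
    unfolding set_integrable_def
    by (rule integrable_mult_indicator[OF _ F_int]) (simp add: that)
  have "(LINT s:{x1<..x2} \<union> {x2<..}|lborel. F s) =
      (LINT s:{x1<..x2}|lborel. F s) + (LINT s:{x2<..}|lborel. F s)"
    by (rule set_integral_Un[OF _ int int]) auto
  moreover have "{x1<..x2} \<union> {x2<..} = {x1<..}"
    using assms by (intro ivl_disj_un_one) simp
  moreover have "(LINT s:{x1<..x2}|lborel. F s) = (LINT s:closed_segment x1 x2|lborel. F s)"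
  proof (rule set_integral_null_delta[OF F_int, symmetric])
    have "sym_diff (closed_segment x1 x2) {x1<..x2} = {x1}"
      using assms by (auto simp: closed_segment_eq_real_ivl)
    then show "sym_diff (closed_segment x1 x2) {x1<..x2} \<in> null_sets lborel"
      by (simp add: finite_imp_null_set_lborel)
  qed (auto simp: borel_closed)
  moreover have "sender_payoff \<alpha> \<beta> \<gamma> \<mu> r x y = (LINT s:{x<..}|lborel. F s)" for x
    unfolding F_def q_def by (rule sender_payoff_eq)
  ultimately have "sender_payoff \<alpha> \<beta> \<gamma> \<mu> r x1 y - sender_payoff \<alpha> \<beta> \<gamma> \<mu> r x2 y =
      (LINT s:closed_segment x1 x2|lborel. F s)"
    by simp
  then show ?thesis
    unfolding F_def q_def .
qed

text \<open>Since \<open>\<gamma> * \<mu> + \<alpha> * y = - \<beta> * X\<close>, the signal enters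
  only through \<open>X\<close>. The affine factor vanishes at \<open>s = X - c\<close>, and the
  mean of \<open>x\<close> given \<open>y\<close> is
  \<open>- \<beta> * X / (\<gamma> + \<alpha>)\<close>, at distance \<open>\<rho> * X\<close> from
  \<open>X\<close>.\<close>

lemma sender_payoff_diff:
  fixes r y z :: real
  defines "X \<equiv> disclosure_threshold \<alpha> \<beta> \<gamma> \<mu> y"
  obtains K where "0 < K"
    "sender_payoff \<alpha> \<beta> \<gamma> \<mu> r X y - sender_payoff \<alpha> \<beta> \<gamma> \<mu> r z y =
      K * ((X - z) * gap ((\<gamma> + \<alpha>) * \<beta> / (\<gamma> + \<alpha> + \<beta>)) (1 + \<beta> / (\<gamma> + \<alpha>)) ((\<gamma> + \<alpha> + \<beta>) * r / \<beta>) z X)"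
proof -
  define q where "q = (\<gamma> + \<alpha>) * \<beta> / (\<gamma> + \<alpha> + \<beta>)"
  define \<rho> where "\<rho> = 1 + \<beta> / (\<gamma> + \<alpha>)"
  define c where "c = (\<gamma> + \<alpha> + \<beta>) * r / \<beta>"
  define m where "m = (\<gamma> * \<mu> + \<alpha> * y) / (\<gamma> + \<alpha>)"
  define F where "F = (\<lambda>s. (r + (\<gamma> * \<mu> + \<alpha> * y + \<beta> * s) / (\<gamma> + \<alpha> + \<beta>)) * normal_prec q m s)"
  have q: "0 < q"
    using pos by (simp add: q_def)
  define K where "K = \<beta> / (\<gamma> + \<alpha> + \<beta>) * sqrt (q / (2 * pi))"
  have K: "0 < K"
    using pos q by (simp add: K_def)
  have X: "\<gamma> * \<mu> + \<alpha> * y = - \<beta> * X"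
    using pos by (simp add: X_def disclosure_threshold_def)
  have F: "F (X + t * (z - X)) =
      - K * (((X - z) * t - c) * exp (- q * ((X - z) * t - \<rho> * X)\<^sup>2 / 2))" for t
  proof -
    have "r + (\<gamma> * \<mu> + \<alpha> * y + \<beta> * (X + t * (z - X))) / (\<gamma> + \<alpha> + \<beta>) =
        - (\<beta> / (\<gamma> + \<alpha> + \<beta>)) * ((X - z) * t - c)"
    proof -
      have c: "\<beta> / (\<gamma> + \<alpha> + \<beta>) * c = r"
        using pos add_pos_pos[OF add_pos_pos[OF pos(3,1)] pos(2)] by (simp add: c_def)
      have "- \<beta> * X + \<beta> * (X + t * (z - X)) = - \<beta> * ((X - z) * t)"
        by (simp add: algebra_simps)
      then show ?thesis
        unfolding X right_diff_distrib mult_minus_left c by simp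
    qed
    moreover have "X + t * (z - X) - m = - ((X - z) * t - \<rho> * X)"
      unfolding m_def X \<rho>_def by (simp add: algebra_simps)
    then have "normal_prec q m (X + t * (z - X)) =
        sqrt (q / (2 * pi)) * exp (- q * ((X - z) * t - \<rho> * X)\<^sup>2 / 2)"
      unfolding normal_prec_eq[OF q] by (simp only: power2_minus)
    ultimately show ?thesis
      unfolding F_def K_def by simp
  qed
  have seg: "(LINT s:closed_segment X z|lborel. F s) = \<bar>z - X\<bar> * (- K * gap q \<rho> c z X)" if "X \<noteq> z"
  proof -
    have "continuous_on (closed_segment X z) F"
      unfolding F_def using q pos by (intro continuous_on_normal_prec continuous_intros) auto
    from set_lebesgue_integral_closed_segment[OF this that]
    show ?thesis
      unfolding F gap_def integral_mult_right .
  qed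
  have "sender_payoff \<alpha> \<beta> \<gamma> \<mu> r X y - sender_payoff \<alpha> \<beta> \<gamma> \<mu> r z y = K * ((X - z) * gap q \<rho> c z X)"
  proof (cases X z rule: linorder_cases)
    case less
    then have "sender_payoff \<alpha> \<beta> \<gamma> \<mu> r X y - sender_payoff \<alpha> \<beta> \<gamma> \<mu> r z y = (LINT s:closed_segment X z|lborel. F s)"
      unfolding F_def q_def m_def by (rule sender_payoff_diff_less)
    then show ?thesis
      using seg less by (simp add: algebra_simps)
  next
    case greater
    then have "sender_payoff \<alpha> \<beta> \<gamma> \<mu> r z y - sender_payoff \<alpha> \<beta> \<gamma> \<mu> r X y = (LINT s:closed_segment X z|lborel. F s)"
      unfolding F_def q_def m_def closed_segment_commute[of X] by (rule sender_payoff_diff_less)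
    then show ?thesis
      using seg greater by (simp add: algebra_simps)
  qed simp
  then show ?thesis
    using that K unfolding q_def \<rho>_def c_def by blast
qed

section \<open>Equilibria\<close>

text \<open>A common form for the beliefs after either kind of message, so that integrability is
  argued once.\<close>

lemma posterior_dens_eq_weighted_normal:
  assumes [measurable]: "Y \<in> sets borel"
  obtains \<tau> M K and v :: "real \<Rightarrow> real" where "0 < \<tau>" "v \<in> borel_measurable borel" "\<And>\<theta>. \<bar>v \<theta>\<bar> \<le> K"
    "posterior_dens \<alpha> \<beta> \<gamma> \<mu> p Y m x = (\<lambda>\<theta>. v \<theta> * normal_prec \<tau> M \<theta>)"
proof (cases m)
  case (Some y)
  show thesis
  proof (rule that[of "\<gamma> + \<beta> + \<alpha>" "\<lambda>_. 1" 1])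
    show "posterior_dens \<alpha> \<beta> \<gamma> \<mu> p Y m x = (\<lambda>\<theta>. 1 * normal_prec (\<gamma> + \<beta> + \<alpha>) (xy_mean x y) \<theta>)"
      using Some by (simp add: posterior_dens_def dens_state_xy_eq fun_eq_iff)
  qed (use pos in auto)
next
  case None
  define D where "D = signal_prob y_prec Y (x_mean x)"
  obtain K where K: "\<And>\<theta>. \<bar>1 - p + p * (signal_prob \<alpha> Y \<theta> / D)\<bar> \<le> K"
    using nondisclosure_weight_bound[OF assms] by blast
  show thesis
  proof (rule that[OF _ _ K])
    show "posterior_dens \<alpha> \<beta> \<gamma> \<mu> p Y m x =
        (\<lambda>\<theta>. (1 - p + p * (signal_prob \<alpha> Y \<theta> / D)) * normal_prec (\<gamma> + \<beta>) (x_mean x) \<theta>)"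
      using None by (simp add: posterior_dens_def dens_nondisclosure_eq fun_eq_iff D_def)
    show "(\<lambda>\<theta>. 1 - p + p * (signal_prob \<alpha> Y \<theta> / D)) \<in> borel_measurable borel"
      by measurable
  qed (use pos in simp)
qed

text \<open>The externality does not depend on the receiver's own action, so the best reply is
  decided by the sign of the posterior mean.\<close>

lemma receiver_payoff_affine:
  assumes Y: "Y \<in> sets borel"
  obtains I where "\<And>a. receiver_payoff r (\<lambda>\<theta>. 1 - cdf_x \<beta> z \<theta>) (posterior_dens \<alpha> \<beta> \<gamma> \<mu> p Y m x) a =
    I + a * (\<integral>\<theta>. \<theta> * posterior_dens \<alpha> \<beta> \<gamma> \<mu> p Y m x \<theta> \<partial>lborel)"
proof (rule posterior_dens_eq_weighted_normal[OF Y, of p m x])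
  fix \<tau> M K v assume v: "0 < \<tau>" "v \<in> borel_measurable borel" "\<And>\<theta>. \<bar>v \<theta>\<bar> \<le> K"
    and post: "posterior_dens \<alpha> \<beta> \<gamma> \<mu> p Y m x = (\<lambda>\<theta>. v \<theta> * normal_prec \<tau> M \<theta>)"
  note [measurable] = v(2)
  have "\<bar>signal_prob \<beta> {z<..} \<theta> * v \<theta>\<bar> \<le> 1 * K" for \<theta>
    using signal_prob_bounds[OF pos(2), of "{z<..}" \<theta>] v(3)[of \<theta>]
    unfolding abs_mult by (intro mult_mono) auto
  then have "integrable lborel (\<lambda>\<theta>. (1 + 0 * \<theta>) * (signal_prob \<beta> {z<..} \<theta> * v \<theta> * normal_prec \<tau> M \<theta>))"
    using v(1) by (intro integrable_bounded_normal_prec[where K="1 * K"]) auto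
  then have 1: "integrable lborel (\<lambda>\<theta>. signal_prob \<beta> {z<..} \<theta> * (v \<theta> * normal_prec \<tau> M \<theta>))"
    by (simp add: mult.assoc)
  have "integrable lborel (\<lambda>\<theta>. (0 + 1 * \<theta>) * (v \<theta> * normal_prec \<tau> M \<theta>))"
    using v by (intro integrable_bounded_normal_prec) auto
  then have 2: "integrable lborel (\<lambda>\<theta>. \<theta> * (v \<theta> * normal_prec \<tau> M \<theta>))"
    by simp
  have "receiver_payoff r (\<lambda>\<theta>. 1 - cdf_x \<beta> z \<theta>) (posterior_dens \<alpha> \<beta> \<gamma> \<mu> p Y m x) a =
      r * (\<integral>\<theta>. signal_prob \<beta> {z<..} \<theta> * (v \<theta> * normal_prec \<tau> M \<theta>) \<partial>lborel) +
      a * (\<integral>\<theta>. \<theta> * posterior_dens \<alpha> \<beta> \<gamma> \<mu> p Y m x \<theta> \<partial>lborel)" for a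
    using 1 2 unfolding receiver_payoff_def cdf_x_complement[OF pos(2)] post
    by (simp add: distrib_right mult.assoc)
  then show thesis by (rule that)
qed

lemma xy_mean_eq: "xy_mean x y = \<beta> / (\<gamma> + \<beta> + \<alpha>) * (x - disclosure_threshold \<alpha> \<beta> \<gamma> \<mu> y)"
proof -
  have "\<beta> * (x - disclosure_threshold \<alpha> \<beta> \<gamma> \<mu> y) = \<gamma> * \<mu> + \<beta> * x + \<alpha> * y"
    using pos by (simp add: disclosure_threshold_def algebra_simps)
  then show ?thesis by simp
qed

lemma posterior_mean_Some:
  "(\<integral>\<theta>. \<theta> * posterior_dens \<alpha> \<beta> \<gamma> \<mu> p Y (Some y) x \<theta> \<partial>lborel) =
    \<beta> / (\<gamma> + \<beta> + \<alpha>) * (x - disclosure_threshold \<alpha> \<beta> \<gamma> \<mu> y)"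
  using integrable_normal_prec_affine(2)[of "\<gamma> + \<beta> + \<alpha>" 0 1 "xy_mean x y"] pos
  unfolding xy_mean_eq[symmetric] by (simp add: posterior_dens_def dens_state_xy_eq)

lemma posterior_mean_None:
  "(\<integral>\<theta>. \<theta> * posterior_dens \<alpha> \<beta> \<gamma> \<mu> p Y None x \<theta> \<partial>lborel) = nondisclosure_mean \<alpha> \<beta> \<gamma> \<mu> p Y x"
  by (simp add: posterior_dens_def nondisclosure_mean_def)

section \<open>The concealment region in terms of signals\<close>

text \<open>The inverse of \<open>disclosure_threshold\<close>.\<close>

definition threshold_signal :: "real \<Rightarrow> real" where
  "threshold_signal X = - (\<beta> * X + \<gamma> * \<mu>) / \<alpha>"

lemma disclosure_threshold_diff:
  "disclosure_threshold \<alpha> \<beta> \<gamma> \<mu> y - X = - (\<alpha> / \<beta>) * (y - threshold_signal X)"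
  using pos by (simp add: disclosure_threshold_def threshold_signal_def field_simps)

lemma disclosure_threshold_eq_iff:
  "disclosure_threshold \<alpha> \<beta> \<gamma> \<mu> y = X \<longleftrightarrow> y = threshold_signal X"
  using disclosure_threshold_diff[of y X] pos by auto

lemma disclosure_threshold_mem_iff:
  "disclosure_threshold \<alpha> \<beta> \<gamma> \<mu> y \<in> closed_segment X X' \<longleftrightarrow>
    y \<in> closed_segment (threshold_signal X) (threshold_signal X')"
proof -
  let ?P = "(y - threshold_signal X) * (y - threshold_signal X')"
  have "(disclosure_threshold \<alpha> \<beta> \<gamma> \<mu> y - X) * (disclosure_threshold \<alpha> \<beta> \<gamma> \<mu> y - X') = (\<alpha> / \<beta>)\<^sup>2 * ?P"
    unfolding disclosure_threshold_diff by (simp add: power2_eq_square)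
  then have "disclosure_threshold \<alpha> \<beta> \<gamma> \<mu> y \<in> closed_segment X X' \<longleftrightarrow> (\<alpha> / \<beta>)\<^sup>2 * ?P \<le> (\<alpha> / \<beta>)\<^sup>2 * 0"
    by (simp only: mem_closed_segment_real_iff mult_zero_right)
  also have "\<dots> \<longleftrightarrow> ?P \<le> 0"
    using pos by (intro mult_le_cancel_left_pos) simp
  finally show ?thesis
    by (simp only: mem_closed_segment_real_iff)
qed

text \<open>Given the threshold \<open>z\<close> after silence, the Sender is indifferent at two
  signals: the one whose disclosure induces \<open>z\<close> itself, and the one inducing the zero
  \<open>R z\<close> of \<open>gap\<close>, where gains and losses along the segment
  balance.\<close>

lemma sender_indifference:
  assumes "r \<noteq> 0"
  obtains R where "continuous_on {l..u} R" "\<And>z. R z \<noteq> z"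
    and "\<And>y z. sender_payoff \<alpha> \<beta> \<gamma> \<mu> r (disclosure_threshold \<alpha> \<beta> \<gamma> \<mu> y) y \<le> sender_payoff \<alpha> \<beta> \<gamma> \<mu> r z y \<longleftrightarrow>
      y \<in> closed_segment (threshold_signal (R z)) (threshold_signal z)"
    and "\<And>y z. sender_payoff \<alpha> \<beta> \<gamma> \<mu> r z y = sender_payoff \<alpha> \<beta> \<gamma> \<mu> r (disclosure_threshold \<alpha> \<beta> \<gamma> \<mu> y) y \<longleftrightarrow>
      y = threshold_signal (R z) \<or> y = threshold_signal z"
proof -
  let ?q = "(\<gamma> + \<alpha>) * \<beta> / (\<gamma> + \<alpha> + \<beta>)" and ?\<rho> = "1 + \<beta> / (\<gamma> + \<alpha>)" and ?c = "(\<gamma> + \<alpha> + \<beta>) * r / \<beta>"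
  have q: "0 < ?q" "1 < ?\<rho>" and c: "?c \<noteq> 0"
    using pos assms add_pos_pos[OF add_pos_pos[OF pos(3,1)] pos(2)] by auto
  show thesis
  proof (rule gap_zero_continuous[OF q c, of l u])
    fix R assume R: "continuous_on {l..u} R"
      "\<And>z X. gap ?q ?\<rho> ?c z X = 0 \<longleftrightarrow> X = R z"
      "\<And>z X. (X - z) * gap ?q ?\<rho> ?c z X \<le> 0 \<longleftrightarrow> X \<in> closed_segment (R z) z"
    have neq: "R z \<noteq> z" for z
    proof -
      \<comment> \<open>At \<open>X = z\<close> the integrand is the constant \<open>- ?c\<close>
        times a positive weight; \<open>r \<noteq> 0\<close> enters here.\<close>
      have "gap ?q ?\<rho> ?c z z \<noteq> 0"
        using c by (simp add: gap_def)
      then show ?thesis using R(2)[of z z] by auto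
    qed
    have le_iff: "sender_payoff \<alpha> \<beta> \<gamma> \<mu> r (disclosure_threshold \<alpha> \<beta> \<gamma> \<mu> y) y \<le> sender_payoff \<alpha> \<beta> \<gamma> \<mu> r z y \<longleftrightarrow>
        y \<in> closed_segment (threshold_signal (R z)) (threshold_signal z)"
      and eq_iff: "sender_payoff \<alpha> \<beta> \<gamma> \<mu> r z y = sender_payoff \<alpha> \<beta> \<gamma> \<mu> r (disclosure_threshold \<alpha> \<beta> \<gamma> \<mu> y) y \<longleftrightarrow>
        y = threshold_signal (R z) \<or> y = threshold_signal z" for y z
    proof -
      define X where "X = disclosure_threshold \<alpha> \<beta> \<gamma> \<mu> y"
      define G where "G = (X - z) * gap ?q ?\<rho> ?c z X"
      obtain K where K: "0 < K" "sender_payoff \<alpha> \<beta> \<gamma> \<mu> r X y - sender_payoff \<alpha> \<beta> \<gamma> \<mu> r z y = K * G"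
        unfolding X_def G_def by (rule sender_payoff_diff)
      have "sender_payoff \<alpha> \<beta> \<gamma> \<mu> r X y \<le> sender_payoff \<alpha> \<beta> \<gamma> \<mu> r z y \<longleftrightarrow> K * G \<le> K * 0"
        unfolding K(2)[symmetric] by auto
      also have "\<dots> \<longleftrightarrow> G \<le> 0"
        using K(1) by (rule mult_le_cancel_left_pos)
      finally show "sender_payoff \<alpha> \<beta> \<gamma> \<mu> r (disclosure_threshold \<alpha> \<beta> \<gamma> \<mu> y) y \<le> sender_payoff \<alpha> \<beta> \<gamma> \<mu> r z y \<longleftrightarrow>
        y \<in> closed_segment (threshold_signal (R z)) (threshold_signal z)"
        unfolding G_def R(3) unfolding X_def disclosure_threshold_mem_iff .
      have "sender_payoff \<alpha> \<beta> \<gamma> \<mu> r z y = sender_payoff \<alpha> \<beta> \<gamma> \<mu> r X y \<longleftrightarrow> K * G = 0"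
        unfolding K(2)[symmetric] by auto
      also have "\<dots> \<longleftrightarrow> X = R z \<or> X = z"
        using K(1) unfolding G_def mult_eq_0_iff R(2) by auto
      finally show "sender_payoff \<alpha> \<beta> \<gamma> \<mu> r z y = sender_payoff \<alpha> \<beta> \<gamma> \<mu> r (disclosure_threshold \<alpha> \<beta> \<gamma> \<mu> y) y \<longleftrightarrow>
        y = threshold_signal (R z) \<or> y = threshold_signal z"
        unfolding X_def disclosure_threshold_eq_iff .
    qed
    show thesis
      using R(1) neq le_iff eq_iff by (rule that)
  qed
qed

text \<open>Neither \<open>R\<close> nor the concealment part \<open>G\<close> involves
  \<open>p\<close>, so a bound for \<open>G\<close> near the zero \<open>z0\<close> of
  \<open>x_mean\<close>, and with it \<open>pbar\<close>, can be fixed before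
  \<open>p\<close>.\<close>

lemma nondisclosure_mean_zero:
  assumes R: "continuous_on {- \<gamma> * \<mu> / \<beta> - 1..- \<gamma> * \<mu> / \<beta> + 1} R" "\<And>z. R z \<noteq> z"
  shows "\<exists>pbar. 0 < pbar \<and> pbar < 1 \<and> (\<forall>p. 0 < p \<longrightarrow> p < pbar \<longrightarrow>
    (\<exists>z. nondisclosure_mean \<alpha> \<beta> \<gamma> \<mu> p (closed_segment (threshold_signal (R z)) (threshold_signal z)) z = 0))"
proof -
  define z0 where "z0 = - \<gamma> * \<mu> / \<beta>"
  define b where "b = \<beta> / (\<gamma> + \<beta>)"
  define G where "G = (\<lambda>z. xy_mean z (segment_mean y_prec (x_mean z) (threshold_signal (R z)) (threshold_signal z)))"
  have b: "0 < b"
    using pos by (simp add: b_def)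
  have x_mean: "x_mean z = b * (z - z0)" for z
  proof -
    have "\<gamma> * \<mu> + \<beta> * z = \<beta> * (z - z0)"
      using pos by (simp add: z0_def field_simps)
    then show ?thesis by (simp add: b_def)
  qed
  have nz: "\<gamma> + \<beta> \<noteq> 0" "\<gamma> + \<beta> + \<alpha> \<noteq> 0"
    using pos by auto
  have G: "continuous_on {z0 - 1..z0 + 1} G"
    using R(1) pos nz y_prec_pos unfolding G_def threshold_signal_def z0_def
    by (intro continuous_intros continuous_on_segment_mean) auto
  then have "bounded (G ` {z0 - 1..z0 + 1})"
    by (intro compact_imp_bounded compact_continuous_image) auto
  then obtain B where B: "0 < B" "\<And>z. z \<in> {z0 - 1..z0 + 1} \<Longrightarrow> \<bar>G z\<bar> \<le> B"
    unfolding bounded_pos by auto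
  \<comment> \<open>Chosen so that \<open>p < pbar\<close> implies
    \<open>p * B \<le> (1 - p) * b\<close>: at distance 1 from \<open>z0\<close> the affine part
    then dominates the concealment part and determines the sign of \<open>H\<close>.\<close>
  define pbar where "pbar = b / (1 + b + B)"
  have "\<exists>z. nondisclosure_mean \<alpha> \<beta> \<gamma> \<mu> p (closed_segment (threshold_signal (R z)) (threshold_signal z)) z = 0"
    if p: "0 < p" "p < pbar" for p
  proof -
    define H where "H = (\<lambda>z. (1 - p) * (b * (z - z0)) + p * G z)"
    have "p * (1 + b + B) < b"
      using p b B(1) unfolding pbar_def by (simp add: pos_less_divide_eq)
    then have pB: "p * B \<le> (1 - p) * b"
      using p by (simp add: algebra_simps)
    have pG: "\<bar>p * G z\<bar> \<le> p * B" if "z \<in> {z0 - 1..z0 + 1}" for z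
      using B(2)[OF that] p by (simp add: abs_mult mult_left_mono)
    have "H (z0 - 1) \<le> 0" "0 \<le> H (z0 + 1)"
      using pB pG[of "z0 - 1"] pG[of "z0 + 1"] unfolding H_def by (simp_all add: abs_le_iff)
    moreover have "continuous_on {z0 - 1..z0 + 1} H"
      unfolding H_def by (intro continuous_intros G)
    ultimately obtain z where "H z = 0"
      using IVT'[of H "z0 - 1" 0 "z0 + 1"] by auto
    moreover have "threshold_signal (R z) \<noteq> threshold_signal z"
      using R(2)[of z] pos by (simp add: threshold_signal_def)
    ultimately show ?thesis
      by (intro exI[of _ z]) (simp add: nondisclosure_mean_closed_segment H_def G_def x_mean[symmetric])
  qed
  moreover have "0 < pbar" "pbar < 1"
    using b B(1) by (simp_all add: pbar_def)
  ultimately show ?thesis by blast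
qed

text \<open>Forwards, indifference fixes the thresholds after disclosure, and the Sender's condition
  makes \<open>Y\<close> the segment between the two indifferent signals. Backwards, the conditions
  on \<open>y1\<close> and \<open>y2\<close> identify these signals, and monotone posterior means
  turn indifference into optimality.\<close>

lemma perfect_bayesian_equilibrium_iff:
  assumes p: "0 < p" "p < 1" and R: "\<And>z. R z \<noteq> z"
    "\<And>y z. sender_payoff \<alpha> \<beta> \<gamma> \<mu> r (disclosure_threshold \<alpha> \<beta> \<gamma> \<mu> y) y \<le> sender_payoff \<alpha> \<beta> \<gamma> \<mu> r z y \<longleftrightarrow>
      y \<in> closed_segment (threshold_signal (R z)) (threshold_signal z)"
    "\<And>y z. sender_payoff \<alpha> \<beta> \<gamma> \<mu> r z y = sender_payoff \<alpha> \<beta> \<gamma> \<mu> r (disclosure_threshold \<alpha> \<beta> \<gamma> \<mu> y) y \<longleftrightarrow>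
      y = threshold_signal (R z) \<or> y = threshold_signal z"
  shows "perfect_bayesian_equilibrium \<alpha> \<beta> \<gamma> \<mu> r p xh Y post A \<longleftrightarrow>
      (\<exists>y1 y2. y1 \<noteq> y2 \<and> Y = closed_segment y1 y2 \<and>
         0 = nondisclosure_mean \<alpha> \<beta> \<gamma> \<mu> p Y (xh None) \<and>
         xh None = disclosure_threshold \<alpha> \<beta> \<gamma> \<mu> y2 \<and>
         sender_payoff \<alpha> \<beta> \<gamma> \<mu> r (xh None) y1 =
           sender_payoff \<alpha> \<beta> \<gamma> \<mu> r (disclosure_threshold \<alpha> \<beta> \<gamma> \<mu> y1) y1 \<and>
         (\<forall>y. xh (Some y) = disclosure_threshold \<alpha> \<beta> \<gamma> \<mu> y) \<and>
         (\<forall>m x \<theta>. post m x \<theta> = posterior_dens \<alpha> \<beta> \<gamma> \<mu> p Y m x \<theta>) \<and>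
         (\<forall>\<theta> m. A \<theta> m = 1 - cdf_x \<beta> (xh m) \<theta>))" (is "?E \<longleftrightarrow> ?T")
proof
  assume E: ?E
  have post: "post m x \<theta> = posterior_dens \<alpha> \<beta> \<gamma> \<mu> p Y m x \<theta>"
    and mean: "(\<integral>\<theta>. \<theta> * post m (xh m) \<theta> \<partial>lborel) = 0"
    and A: "A \<theta> m = 1 - cdf_x \<beta> (xh m) \<theta>"
    and sender: "sender_payoff \<alpha> \<beta> \<gamma> \<mu> r (xh (Some y)) y \<le> sender_payoff \<alpha> \<beta> \<gamma> \<mu> r (xh None) y \<longleftrightarrow> y \<in> Y"
    for m x \<theta> y
    using E unfolding perfect_bayesian_equilibrium_def by blast+
  have xh: "xh (Some y) = disclosure_threshold \<alpha> \<beta> \<gamma> \<mu> y" for y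
    using mean[of "Some y"] pos unfolding post posterior_mean_Some by auto
  define y1 y2 where "y1 = threshold_signal (R (xh None))" and "y2 = threshold_signal (xh None)"
  have "Y = closed_segment y1 y2"
    using sender unfolding xh R(2) y1_def y2_def by blast
  moreover have "y1 \<noteq> y2"
    using R(1)[of "xh None"] pos by (simp add: threshold_signal_def y1_def y2_def)
  moreover have "0 = nondisclosure_mean \<alpha> \<beta> \<gamma> \<mu> p Y (xh None)"
    using mean[of None] unfolding post posterior_mean_None ..
  moreover have "xh None = disclosure_threshold \<alpha> \<beta> \<gamma> \<mu> y2"
    using disclosure_threshold_eq_iff[of y2 "xh None"] by (simp add: y2_def)
  moreover have "sender_payoff \<alpha> \<beta> \<gamma> \<mu> r (xh None) y1 =
      sender_payoff \<alpha> \<beta> \<gamma> \<mu> r (disclosure_threshold \<alpha> \<beta> \<gamma> \<mu> y1) y1"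
    unfolding R(3) y1_def by simp
  ultimately show ?T
    using xh post A by blast
next
  assume ?T
  then obtain y1 y2 where y: "y1 \<noteq> y2" and Y: "Y = closed_segment y1 y2"
    and mean: "0 = nondisclosure_mean \<alpha> \<beta> \<gamma> \<mu> p Y (xh None)"
    and y2: "xh None = disclosure_threshold \<alpha> \<beta> \<gamma> \<mu> y2"
    and y1: "sender_payoff \<alpha> \<beta> \<gamma> \<mu> r (xh None) y1 =
           sender_payoff \<alpha> \<beta> \<gamma> \<mu> r (disclosure_threshold \<alpha> \<beta> \<gamma> \<mu> y1) y1"
    and xh: "\<And>y. xh (Some y) = disclosure_threshold \<alpha> \<beta> \<gamma> \<mu> y"
    and post: "\<And>m x \<theta>. post m x \<theta> = posterior_dens \<alpha> \<beta> \<gamma> \<mu> p Y m x \<theta>"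
    and A: "\<And>\<theta> m. A \<theta> m = 1 - cdf_x \<beta> (xh m) \<theta>"
    by blast
  have Y_borel: "Y \<in> sets borel"
    unfolding Y by (simp add: borel_closed)
  have y2': "y2 = threshold_signal (xh None)"
    using disclosure_threshold_eq_iff y2 by metis
  \<comment> \<open>\<open>y1\<close> is an indifferent signal other than \<open>y2\<close>, so only
    one candidate remains.\<close>
  then have y1': "y1 = threshold_signal (R (xh None))"
    using y1 y unfolding R(3) by blast
  define mu where "mu = (\<lambda>m x. \<integral>\<theta>. \<theta> * posterior_dens \<alpha> \<beta> \<gamma> \<mu> p Y m x \<theta> \<partial>lborel)"
  have mu_zero: "mu m (xh m) = 0" for m
    by (cases m) (simp_all add: mu_def posterior_mean_Some posterior_mean_None xh mean[symmetric])
  have mu_strict: "mu m x < mu m x'" if "x < x'" for m x x'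
  proof (cases m)
    case None
    then show ?thesis
      using nondisclosure_mean_less[OF y, of p x x'] p that
      by (simp add: mu_def posterior_mean_None Y)
  next
    case (Some y)
    then show ?thesis
      using that pos by (simp add: mu_def posterior_mean_Some divide_strict_right_mono)
  qed
  have "receiver_payoff r (\<lambda>\<theta>. A \<theta> m) (post m x) a
      \<le> receiver_payoff r (\<lambda>\<theta>. A \<theta> m) (post m x) (if x \<ge> xh m then 1 else 0)" if "a \<in> {0, 1}" for m x a
  proof -
    have "post m x = posterior_dens \<alpha> \<beta> \<gamma> \<mu> p Y m x"
      by (simp add: fun_eq_iff post)
    then obtain I where I: "\<And>a. receiver_payoff r (\<lambda>\<theta>. A \<theta> m) (post m x) a = I + a * mu m x"
      using receiver_payoff_affine[OF Y_borel, of r "xh m" p m x] unfolding A mu_def by metis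
    show ?thesis
      \<comment> \<open>The posterior mean has the sign of \<open>x - xh m\<close>; at the threshold
        both actions are optimal.\<close>
      using mu_strict[of x "xh m" m] mu_strict[of "xh m" x m] mu_zero[of m] that
      unfolding I by (cases x "xh m" rule: linorder_cases) auto
  qed
  moreover have "(\<integral>\<theta>. \<theta> * post m (xh m) \<theta> \<partial>lborel) = 0" for m
    using mu_zero[of m] by (simp add: mu_def post)
  moreover have "sender_payoff \<alpha> \<beta> \<gamma> \<mu> r (xh (Some y)) y \<le> sender_payoff \<alpha> \<beta> \<gamma> \<mu> r (xh None) y \<longleftrightarrow> y \<in> Y" for y
    unfolding xh R(2) Y y1'[symmetric] y2'[symmetric] ..
  ultimately show ?E
    unfolding perfect_bayesian_equilibrium_def using post A by blast
qed

end

text \<open>For \<open>r = 0\<close> the Sender's preferred threshold would coincide with that of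
  the receivers and the region would shrink to a point; \<open>r \<noteq> 0\<close> keeps
  \<open>y1\<close> and \<open>y2\<close> apart. Smallness of \<open>p\<close> provides the
  threshold after silence.\<close>

theorem theorem3p4:
  fixes \<alpha> \<beta> \<gamma> \<mu> r :: real
  assumes "\<alpha> > 0" and "\<beta> > 0" and "\<gamma> > 0" and "r \<noteq> 0"
  shows "\<exists>pbar. 0 < pbar \<and> pbar < 1 \<and> (\<forall>p. 0 < p \<and> p < pbar \<longrightarrow>
    (\<exists>xh Y post A. perfect_bayesian_equilibrium \<alpha> \<beta> \<gamma> \<mu> r p xh Y post A) \<and>
    (\<forall>xh Y post A. perfect_bayesian_equilibrium \<alpha> \<beta> \<gamma> \<mu> r p xh Y post A \<longleftrightarrow>
      (\<exists>y1 y2. y1 \<noteq> y2 \<and> Y = closed_segment y1 y2 \<and>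
         0 = nondisclosure_mean \<alpha> \<beta> \<gamma> \<mu> p Y (xh None) \<and>
         xh None = disclosure_threshold \<alpha> \<beta> \<gamma> \<mu> y2 \<and>
         sender_payoff \<alpha> \<beta> \<gamma> \<mu> r (xh None) y1 =
           sender_payoff \<alpha> \<beta> \<gamma> \<mu> r (disclosure_threshold \<alpha> \<beta> \<gamma> \<mu> y1) y1 \<and>
         (\<forall>y. xh (Some y) = disclosure_threshold \<alpha> \<beta> \<gamma> \<mu> y) \<and>
         (\<forall>m x \<theta>. post m x \<theta> = posterior_dens \<alpha> \<beta> \<gamma> \<mu> p Y m x \<theta>) \<and>
         (\<forall>\<theta> m. A \<theta> m = 1 - cdf_x \<beta> (xh m) \<theta>))))"
proof -
  note pos = assms(1-3)
  let ?ts = "threshold_signal \<alpha> \<beta> \<gamma> \<mu>"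
  \<comment> \<open>\<open>l\<close> and \<open>u\<close> lie at distance 1 from the zero of the
    mean given \<open>x\<close> alone, the interval on which \<open>nondisclosure_mean_zero\<close>
    needs continuity.\<close>
  show ?thesis
  proof (rule sender_indifference[OF pos \<open>r \<noteq> 0\<close>, where \<mu>=\<mu>
      and l="- \<gamma> * \<mu> / \<beta> - 1" and u="- \<gamma> * \<mu> / \<beta> + 1"])
    fix R assume R: "continuous_on {- \<gamma> * \<mu> / \<beta> - 1..- \<gamma> * \<mu> / \<beta> + 1} R" "\<And>z. R z \<noteq> z"
      "\<And>y z. sender_payoff \<alpha> \<beta> \<gamma> \<mu> r (disclosure_threshold \<alpha> \<beta> \<gamma> \<mu> y) y \<le> sender_payoff \<alpha> \<beta> \<gamma> \<mu> r z y \<longleftrightarrow>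
        y \<in> closed_segment (?ts (R z)) (?ts z)"
      "\<And>y z. sender_payoff \<alpha> \<beta> \<gamma> \<mu> r z y = sender_payoff \<alpha> \<beta> \<gamma> \<mu> r (disclosure_threshold \<alpha> \<beta> \<gamma> \<mu> y) y \<longleftrightarrow>
        y = ?ts (R z) \<or> y = ?ts z"
    obtain pbar where pbar: "0 < pbar" "pbar < 1"
      and zero: "\<And>p. 0 < p \<Longrightarrow> p < pbar \<Longrightarrow>
        \<exists>z. nondisclosure_mean \<alpha> \<beta> \<gamma> \<mu> p (closed_segment (?ts (R z)) (?ts z)) z = 0"
      using nondisclosure_mean_zero[OF pos R(1,2)] by blast
    show ?thesis
    proof (intro exI[of _ pbar] conjI allI impI pbar)
      fix p assume p: "0 < p \<and> p < pbar"
      then have "p < 1" using pbar by simp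
      note iff = perfect_bayesian_equilibrium_iff[OF pos conjunct1[OF p] this, of R, OF R(2-4)]
      obtain z where z: "nondisclosure_mean \<alpha> \<beta> \<gamma> \<mu> p (closed_segment (?ts (R z)) (?ts z)) z = 0"
        using zero p by blast
      \<comment> \<open>The candidate equilibrium conceals between \<open>?ts (R z)\<close>, in the
        role of \<open>y1\<close>, and \<open>?ts z\<close>, in the role of
        \<open>y2\<close>.\<close>
      define Y where "Y = closed_segment (?ts (R z)) (?ts z)"
      define xh where "xh = (\<lambda>m. case m of None \<Rightarrow> z | Some y \<Rightarrow> disclosure_threshold \<alpha> \<beta> \<gamma> \<mu> y)"
      have "perfect_bayesian_equilibrium \<alpha> \<beta> \<gamma> \<mu> r p xh Y (posterior_dens \<alpha> \<beta> \<gamma> \<mu> p Y)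
          (\<lambda>\<theta> m. 1 - cdf_x \<beta> (xh m) \<theta>)"
        unfolding iff
      proof (rule exI[of _ "?ts (R z)"], rule exI[of _ "?ts z"], intro conjI allI refl)
        show "?ts (R z) \<noteq> ?ts z"
          using R(2)[of z] pos by (simp add: threshold_signal_def[OF pos])
        show "xh None = disclosure_threshold \<alpha> \<beta> \<gamma> \<mu> (?ts z)"
          using disclosure_threshold_eq_iff[OF pos, of \<mu> "?ts z" z] by (simp add: xh_def)
        show "sender_payoff \<alpha> \<beta> \<gamma> \<mu> r (xh None) (?ts (R z)) =
            sender_payoff \<alpha> \<beta> \<gamma> \<mu> r (disclosure_threshold \<alpha> \<beta> \<gamma> \<mu> (?ts (R z))) (?ts (R z))"
          unfolding R(4) by (simp add: xh_def)
      qed (simp_all add: xh_def z Y_def)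
      then show "\<exists>xh Y post A. perfect_bayesian_equilibrium \<alpha> \<beta> \<gamma> \<mu> r p xh Y post A"
        by blast
    qed (rule perfect_bayesian_equilibrium_iff[OF pos _ _ R(2-4)], use pbar in auto)
  qed
qed

end
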